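(* The following assertions hold: (1) If $A$ is a strongly ISP-ring and $P$ a prime ideal of $A$, then $A/P$ is an ISP-domain. (2) If $S$ is a multiplicatively closed set of a strongly ISP-ring $A$, then $A_S$ is a strongly ISP-ring. (3) A finite direct product $A_1\times\cdots\times A_n$ of rings is a strongly ISP-ring if and only if each $A_i$ is a strongly ISP-ring.
   Context: All rings are commutative with a nonzero unit. An element of a ring is regular if it is not a zero-divisor; an ideal is regular if it contains at least one regular element. A proper ideal $H$ is a radical ideal if $\sqrt H=H$. An ideal $J$ of $A$ is invertible if $JJ'=A$ for some $A$-submodule $J'$ of the total quotient ring $T(A)$; equivalently, $J$ is finitely generated, regular, and $J_M$ is a principal ideal of $A_M$ for each maximal ideal $M$ of $A$ (the ideal $A$ itself is allowed). A ring is a strongly ISP-ring if every proper ideal of it (including the zero ideal) can be written as $JH_1\cdots H_n$ with $J$ an invertible ideal, $n\ge 1$, and all $H_i$ proper radical ideals. An ISP-domain is an integral domain all of whose proper ideals have such a factorization. *)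

theory Defs
  imports "HOL-Algebra.Algebra"
begin

section \<open>Rings of fractions\<close>

text \<open>
  Fractions \<open>a/s\<close> are classes of pairs \<open>(a, s)\<close>. The factor \<open>u\<close> is needed because \<open>S\<close> may
  contain zero-divisors. The construction is meant for a submonoid \<open>S\<close> of a commutative ring.
\<close>

definition frac_rel :: "('a, 'm) ring_scheme \<Rightarrow> 'a set \<Rightarrow> (('a \<times> 'a) \<times> ('a \<times> 'a)) set" where
  "frac_rel R S = {((a, s), (b, t)). a \<in> carrier R \<and> s \<in> S \<and> b \<in> carrier R \<and> t \<in> S \<and>
     (\<exists>u\<in>S. u \<otimes>\<^bsub>R\<^esub> (a \<otimes>\<^bsub>R\<^esub> t) = u \<otimes>\<^bsub>R\<^esub> (b \<otimes>\<^bsub>R\<^esub> s))}"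

definition fraction :: "('a, 'm) ring_scheme \<Rightarrow> 'a set \<Rightarrow> 'a \<Rightarrow> 'a \<Rightarrow> ('a \<times> 'a) set" where
  "fraction R S a s = frac_rel R S `` {(a, s)}"

text \<open>
  The operations are the usual ones on representatives; since these are compatible with
  \<^const>\<open>frac_rel\<close>, each union below is a union of copies of a single class.
\<close>

definition localization :: "('a, 'm) ring_scheme \<Rightarrow> 'a set \<Rightarrow> ('a \<times> 'a) set ring" where
  "localization R S =
    \<lparr> carrier = (carrier R \<times> S) // frac_rel R S,
      monoid.mult = (\<lambda>x y. \<Union>(a, s)\<in>x. \<Union>(b, t)\<in>y. fraction R S (a \<otimes>\<^bsub>R\<^esub> b) (s \<otimes>\<^bsub>R\<^esub> t)),
      one = fraction R S \<one>\<^bsub>R\<^esub> \<one>\<^bsub>R\<^esub>,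
      ring.zero = fraction R S \<zero>\<^bsub>R\<^esub> \<one>\<^bsub>R\<^esub>,
      ring.add = (\<lambda>x y. \<Union>(a, s)\<in>x. \<Union>(b, t)\<in>y.
               fraction R S ((a \<otimes>\<^bsub>R\<^esub> t) \<oplus>\<^bsub>R\<^esub> (b \<otimes>\<^bsub>R\<^esub> s)) (s \<otimes>\<^bsub>R\<^esub> t)) \<rparr>"

definition regular_elements :: "('a, 'm) ring_scheme \<Rightarrow> 'a set" where
  "regular_elements R =
    {r \<in> carrier R. \<forall>x\<in>carrier R. r \<otimes>\<^bsub>R\<^esub> x = \<zero>\<^bsub>R\<^esub> \<longrightarrow> x = \<zero>\<^bsub>R\<^esub>}"

definition total_quotient_ring :: "('a, 'm) ring_scheme \<Rightarrow> ('a \<times> 'a) set ring" where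
  "total_quotient_ring R = localization R (regular_elements R)"

definition to_total_quotient :: "('a, 'm) ring_scheme \<Rightarrow> 'a \<Rightarrow> ('a \<times> 'a) set" where
  "to_total_quotient R a = fraction R (regular_elements R) a \<one>\<^bsub>R\<^esub>"

definition total_quotient_module :: "('a, 'm) ring_scheme \<Rightarrow> ('a, ('a \<times> 'a) set) module" where
  "total_quotient_module R = ring.extend (total_quotient_ring R)
    \<lparr> smult = (\<lambda>a x. to_total_quotient R a \<otimes>\<^bsub>total_quotient_ring R\<^esub> x) \<rparr>"


section \<open>Invertible and radical ideals\<close>

text \<open>
  In \<open>J J' = R\<close> the ring \<open>R\<close> and its ideal \<open>J\<close> are read inside the total quotient ring. The set
  \<^const>\<open>ideal_prod\<close> of finite sums of products is meaningful for arbitrary submodules of the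
  ambient ring, and is used here for \<open>J'\<close>, which in general is not an ideal.
\<close>

definition invertible_ideal :: "('a, 'm) ring_scheme \<Rightarrow> 'a set \<Rightarrow> bool" where
  "invertible_ideal R J \<longleftrightarrow> ideal J R \<and>
    (\<exists>J'. submodule J' R (total_quotient_module R) \<and>
      ideal_prod (total_quotient_ring R) (to_total_quotient R ` J) J'
        = to_total_quotient R ` carrier R)"

definition ideal_radical :: "('a, 'm) ring_scheme \<Rightarrow> 'a set \<Rightarrow> 'a set" where
  "ideal_radical R I = {x \<in> carrier R. \<exists>n::nat. n \<ge> 1 \<and> x [^]\<^bsub>R\<^esub> n \<in> I}"

definition proper_radical_ideal :: "('a, 'm) ring_scheme \<Rightarrow> 'a set \<Rightarrow> bool" where
  "proper_radical_ideal R H \<longleftrightarrow> ideal H R \<and> H \<noteq> carrier R \<and> ideal_radical R H = H"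


section \<open>ISP factorizations\<close>

locale nonzero_cring = cring +
  assumes one_not_zero: "\<one> \<noteq> \<zero>"

text \<open>\<open>foldl\<close> yields \<open>(\<dots>((J H\<^sub>1) H\<^sub>2) \<dots>) H\<^sub>n\<close>.\<close>

definition has_ISP_factorization :: "('a, 'm) ring_scheme \<Rightarrow> 'a set \<Rightarrow> bool" where
  "has_ISP_factorization R I \<longleftrightarrow>
    (\<exists>J Hs. invertible_ideal R J \<and> Hs \<noteq> [] \<and> (\<forall>H\<in>set Hs. proper_radical_ideal R H) \<and>
      I = foldl (ideal_prod R) J Hs)"

definition strongly_ISP_ring :: "('a, 'm) ring_scheme \<Rightarrow> bool" where
  "strongly_ISP_ring R \<longleftrightarrow> nonzero_cring R \<and>
    (\<forall>I. ideal I R \<and> I \<noteq> carrier R \<longrightarrow> has_ISP_factorization R I)"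

definition ISP_domain :: "('a, 'm) ring_scheme \<Rightarrow> bool" where
  "ISP_domain R \<longleftrightarrow> domain R \<and>
    (\<forall>I. ideal I R \<and> I \<noteq> carrier R \<longrightarrow> has_ISP_factorization R I)"

end

theory Submission
  imports Defs
begin

text \<open>
  An ideal \<open>J\<close> is invertible iff \<open>J K = (r)\<close> for some ideal \<open>K\<close> and regular \<open>r\<close>, and then it divides
  every principal ideal that it contains.

  If \<open>h\<close> is a surjection and the preimage of \<open>I\<close> factors as \<open>J H\<^sub>1 \<dots> H\<^sub>n\<close>, then all factors contain the
  kernel, so the images of the \<open>H\<^sub>i\<close> are again proper radical ideals, and the image of \<open>J\<close> is
  invertible as soon as it contains a regular element. This gives the quotients \<open>A/P\<close> and the
  factors of a direct product. For rings of fractions one extends the factorization of the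
  contraction of \<open>I\<close> and drops the factors that become trivial; not all \<open>H\<^sub>i\<close> can. In a direct
  product \<open>I \<times> K\<close> is the product of the factorizations of \<open>I\<close> and \<open>K\<close>, padded by unit ideals.
\<close>

section \<open>Rings of fractions\<close>

text \<open>Invertibility is defined inside the total quotient ring T(A), which is not functorial:
  the residue map modulo \<open>P\<close> may send regular elements to zero, and then a submodule of
  T(A) has no image in T(A/P). So T(A) is used only to reach J K = (r), an equation between ideals
  of the ring itself. Localization keeps r regular, so there the equation is extended as it stands.
  Modulo \<open>P\<close> it may degenerate to J K = 0, and r has to be exchanged for an element of
  J with nonzero image. A nonzero ideal of A/P supplies one, because its contraction lies in J and
  is not contained in \<open>P\<close>. The zero ideal supplies none, but it is itself a radical
  ideal since A/P is a domain.

  For fractions the obstacle is that a radical ideal meeting \<open>S\<close> extends to the unit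
  ideal, so properness of the factors can be lost. In a product, the two coordinates of an ideal may
  need different numbers of radical factors, and one coordinate may be the whole ring, with no such
  factor at all.\<close>

lemma (in cring) idealI_cring:
  assumes "I \<subseteq> carrier R" "\<zero> \<in> I"
    and "\<And>x y. \<lbrakk>x \<in> I; y \<in> I\<rbrakk> \<Longrightarrow> x \<oplus> y \<in> I"
    and "\<And>x a. \<lbrakk>x \<in> I; a \<in> carrier R\<rbrakk> \<Longrightarrow> a \<otimes> x \<in> I"
  shows "ideal I R"
proof (rule idealI)
  show "ring R" by (rule ring_axioms)
  show "subgroup I (add_monoid R)"
  proof (rule group.subgroupI)
    show "group (add_monoid R)" using add.is_group .
    fix x assume x: "x \<in> I"
    have "\<ominus> x = (\<ominus> \<one>) \<otimes> x" using x assms(1) by (simp add: l_minus subset_iff)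
    then show "inv\<^bsub>add_monoid R\<^esub> x \<in> I" using assms(4)[OF x, of "\<ominus> \<one>"] by (simp add: a_inv_def)
  qed (use assms in auto)
  fix a x assume "a \<in> I" "x \<in> carrier R"
  then show "x \<otimes> a \<in> I" "a \<otimes> x \<in> I" using assms(1,4) m_comm[of a x] by auto
qed

text \<open>The operations of \<open>localization\<close> are unions over all pairs of
  representatives; this evaluates them once independence of the representatives is known.\<close>

lemma UN2_constant:
  assumes "\<And>x y. x \<in> A \<Longrightarrow> y \<in> B \<Longrightarrow> f x y = C" "A \<noteq> {}" "B \<noteq> {}"
  shows "(\<Union>x\<in>A. (\<Union>y\<in>B. f x y)) = C"
  using assms by auto

locale fractions = cring R + U: submonoid U R for R (structure) and U
begin

lemma U_carrier [simp]: "u \<in> U \<Longrightarrow> u \<in> carrier R"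
  using U.subset by blast

lemma equiv_frac_rel: "equiv (carrier R \<times> U) (frac_rel R U)"
proof (rule equivI)
  show "refl_on (carrier R \<times> U) (frac_rel R U)"
    using U.one_closed by (auto simp: refl_on_def frac_rel_def)
  show "frac_rel R U \<subseteq> (carrier R \<times> U) \<times> (carrier R \<times> U)"
    by (auto simp: frac_rel_def)
  show "sym (frac_rel R U)"
    by (rule symI) (auto simp: frac_rel_def, metis)
  show "trans (frac_rel R U)"
  proof (rule transI, clarify)
    fix a s b t c q
    assume "((a, s), (b, t)) \<in> frac_rel R U" "((b, t), (c, q)) \<in> frac_rel R U"
    then obtain u v where
      c: "a \<in> carrier R" "b \<in> carrier R" "c \<in> carrier R" "s \<in> U" "t \<in> U" "q \<in> U" "u \<in> U" "v \<in> U"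
      and e: "u \<otimes> (a \<otimes> t) = u \<otimes> (b \<otimes> s)" "v \<otimes> (b \<otimes> q) = v \<otimes> (c \<otimes> t)"
      by (auto simp: frac_rel_def)
    \<comment> \<open>The witness needs the factor \<open>t\<close>: the middle denominator occurs
      in both equations and cannot be cancelled.\<close>
    have "(u \<otimes> v \<otimes> t) \<otimes> (a \<otimes> q) = (u \<otimes> (a \<otimes> t)) \<otimes> (v \<otimes> q)" using c by (simp add: m_ac)
    also have "\<dots> = (v \<otimes> (b \<otimes> q)) \<otimes> (u \<otimes> s)" using c by (simp add: e(1) m_ac)
    also have "\<dots> = (u \<otimes> v \<otimes> t) \<otimes> (c \<otimes> s)" using c by (simp add: e(2) m_ac)
    finally have "(u \<otimes> v \<otimes> t) \<otimes> (a \<otimes> q) = (u \<otimes> v \<otimes> t) \<otimes> (c \<otimes> s)" .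
    moreover have "u \<otimes> v \<otimes> t \<in> U" using c by simp
    ultimately show "((a, s), (c, q)) \<in> frac_rel R U" using c unfolding frac_rel_def by blast
  qed
qed

lemma mem_fraction_iff:
  "(b, t) \<in> fraction R U a s \<longleftrightarrow> ((a, s), (b, t)) \<in> frac_rel R U"
  by (simp add: fraction_def)

lemma fraction_eq_iff:
  assumes "a \<in> carrier R" "s \<in> U" "b \<in> carrier R" "t \<in> U"
  shows "fraction R U a s = fraction R U b t \<longleftrightarrow> (\<exists>u\<in>U. u \<otimes> (a \<otimes> t) = u \<otimes> (b \<otimes> s))"
  using eq_equiv_class_iff[OF equiv_frac_rel, of "(a, s)" "(b, t)"] assms
  by (simp add: fraction_def frac_rel_def)

lemma fraction_eqI:
  assumes "a \<in> carrier R" "s \<in> U" "b \<in> carrier R" "t \<in> U" "a \<otimes> t = b \<otimes> s"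
  shows "fraction R U a s = fraction R U b t"
  using assms U.one_closed fraction_eq_iff by auto

lemma fraction_self: "a \<in> carrier R \<Longrightarrow> s \<in> U \<Longrightarrow> (a, s) \<in> fraction R U a s"
  using U.one_closed by (auto simp: mem_fraction_iff frac_rel_def)

lemma fraction_mult:
  assumes "a \<in> carrier R" "s \<in> U" "b \<in> carrier R" "t \<in> U"
  shows "fraction R U a s \<otimes>\<^bsub>localization R U\<^esub> fraction R U b t = fraction R U (a \<otimes> b) (s \<otimes> t)"
proof -
  \<comment> \<open>Independence of representatives: the product of the two witnesses is a witness
    for the product of the fractions.\<close>
  have const: "fraction R U (a' \<otimes> b') (s' \<otimes> t') = fraction R U (a \<otimes> b) (s \<otimes> t)"
    if mem: "(a', s') \<in> fraction R U a s" "(b', t') \<in> fraction R U b t" for a' s' b' t'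
  proof -
    obtain u v where c: "a' \<in> carrier R" "s' \<in> U" "b' \<in> carrier R" "t' \<in> U" "u \<in> U" "v \<in> U"
      and e: "u \<otimes> (a \<otimes> s') = u \<otimes> (a' \<otimes> s)" "v \<otimes> (b \<otimes> t') = v \<otimes> (b' \<otimes> t)"
      using mem by (auto simp: mem_fraction_iff frac_rel_def)
    have "(u \<otimes> v) \<otimes> ((a' \<otimes> b') \<otimes> (s \<otimes> t)) = (u \<otimes> (a' \<otimes> s)) \<otimes> (v \<otimes> (b' \<otimes> t))"
      using c assms by (simp add: m_ac)
    also have "\<dots> = (u \<otimes> (a \<otimes> s')) \<otimes> (v \<otimes> (b \<otimes> t'))" by (simp only: e)
    also have "\<dots> = (u \<otimes> v) \<otimes> ((a \<otimes> b) \<otimes> (s' \<otimes> t'))" using c assms by (simp add: m_ac)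
    finally show ?thesis
      using c assms by (subst fraction_eq_iff) (auto intro!: bexI[of _ "u \<otimes> v"])
  qed
  show ?thesis
    unfolding localization_def case_prod_unfold monoid.simps ring.simps
    using fraction_self[OF assms(1,2)] fraction_self[OF assms(3,4)]
    by (intro UN2_constant const) auto
qed

lemma fraction_add:
  assumes "a \<in> carrier R" "s \<in> U" "b \<in> carrier R" "t \<in> U"
  shows "fraction R U a s \<oplus>\<^bsub>localization R U\<^esub> fraction R U b t
    = fraction R U (a \<otimes> t \<oplus> b \<otimes> s) (s \<otimes> t)"
proof -
  have const: "fraction R U (a' \<otimes> t' \<oplus> b' \<otimes> s') (s' \<otimes> t')
      = fraction R U (a \<otimes> t \<oplus> b \<otimes> s) (s \<otimes> t)"
    if mem: "(a', s') \<in> fraction R U a s" "(b', t') \<in> fraction R U b t" for a' s' b' t'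
  proof -
    obtain u v where c: "a' \<in> carrier R" "s' \<in> U" "b' \<in> carrier R" "t' \<in> U" "u \<in> U" "v \<in> U"
      and e: "u \<otimes> (a \<otimes> s') = u \<otimes> (a' \<otimes> s)" "v \<otimes> (b \<otimes> t') = v \<otimes> (b' \<otimes> t)"
      using mem by (auto simp: mem_fraction_iff frac_rel_def)
    have "(u \<otimes> v) \<otimes> ((a' \<otimes> t' \<oplus> b' \<otimes> s') \<otimes> (s \<otimes> t))
        = (u \<otimes> (a' \<otimes> s)) \<otimes> (v \<otimes> (t' \<otimes> t)) \<oplus> (v \<otimes> (b' \<otimes> t)) \<otimes> (u \<otimes> (s' \<otimes> s))"
      using c assms by (simp add: m_ac l_distr r_distr)
    also have "\<dots> = (u \<otimes> (a \<otimes> s')) \<otimes> (v \<otimes> (t' \<otimes> t)) \<oplus> (v \<otimes> (b \<otimes> t')) \<otimes> (u \<otimes> (s' \<otimes> s))"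
      by (simp only: e)
    also have "\<dots> = (u \<otimes> v) \<otimes> ((a \<otimes> t \<oplus> b \<otimes> s) \<otimes> (s' \<otimes> t'))"
      using c assms by (simp add: m_ac l_distr r_distr)
    finally show ?thesis
      using c assms by (subst fraction_eq_iff) (auto intro!: bexI[of _ "u \<otimes> v"])
  qed
  show ?thesis
    unfolding localization_def case_prod_unfold monoid.simps ring.simps
    using fraction_self[OF assms(1,2)] fraction_self[OF assms(3,4)]
    by (intro UN2_constant const) auto
qed

lemma localization_zero: "\<zero>\<^bsub>localization R U\<^esub> = fraction R U \<zero> \<one>"
  and localization_one: "\<one>\<^bsub>localization R U\<^esub> = fraction R U \<one> \<one>"
  by (simp_all add: localization_def)

lemma localization_carrier:
  "carrier (localization R U) = {fraction R U a s | a s. a \<in> carrier R \<and> s \<in> U}"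
  by (auto simp: localization_def quotient_def fraction_def)

lemma fraction_in_carrier:
  "a \<in> carrier R \<Longrightarrow> s \<in> U \<Longrightarrow> fraction R U a s \<in> carrier (localization R U)"
  by (auto simp: localization_carrier)

lemma cring_localization: "cring (localization R U)" (is "cring ?L")
proof (rule cringI)
  have elem: "\<exists>a s. x = fraction R U a s \<and> a \<in> carrier R \<and> s \<in> U" if "x \<in> carrier ?L" for x
    using that by (auto simp: localization_carrier)
  show "abelian_group ?L"
  proof (rule abelian_groupI)
    fix x y z assume "x \<in> carrier ?L" "y \<in> carrier ?L" "z \<in> carrier ?L"
    then obtain a s b t c q where x: "x = fraction R U a s" "a \<in> carrier R" "s \<in> U"
      and y: "y = fraction R U b t" "b \<in> carrier R" "t \<in> U"
      and z: "z = fraction R U c q" "c \<in> carrier R" "q \<in> U"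
      using elem by metis
    show "x \<oplus>\<^bsub>?L\<^esub> y \<oplus>\<^bsub>?L\<^esub> z = x \<oplus>\<^bsub>?L\<^esub> (y \<oplus>\<^bsub>?L\<^esub> z)"
      using x(2,3) y(2,3) z(2,3) unfolding x(1) y(1) z(1)
      by (simp add: fraction_add) (intro fraction_eqI, auto simp: l_distr r_distr m_ac a_ac)
  next
    fix x y assume "x \<in> carrier ?L" "y \<in> carrier ?L"
    then obtain a s b t where x: "x = fraction R U a s" "a \<in> carrier R" "s \<in> U"
      and y: "y = fraction R U b t" "b \<in> carrier R" "t \<in> U"
      using elem by metis
    show "x \<oplus>\<^bsub>?L\<^esub> y \<in> carrier ?L"
      using x(2,3) y(2,3) unfolding x(1) y(1) by (simp add: fraction_add fraction_in_carrier)
    show "x \<oplus>\<^bsub>?L\<^esub> y = y \<oplus>\<^bsub>?L\<^esub> x"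
      using x(2,3) y(2,3) unfolding x(1) y(1) by (simp add: fraction_add m_ac a_ac)
  next
    fix x assume "x \<in> carrier ?L"
    then obtain a s where x: "x = fraction R U a s" "a \<in> carrier R" "s \<in> U"
      using elem by metis
    show "\<zero>\<^bsub>?L\<^esub> \<oplus>\<^bsub>?L\<^esub> x = x"
      using x(2,3) unfolding x(1) localization_zero by (simp add: fraction_add)
    have "fraction R U (\<ominus> a) s \<oplus>\<^bsub>?L\<^esub> x = \<zero>\<^bsub>?L\<^esub>"
      using x(2,3) unfolding x(1) localization_zero
      by (simp add: fraction_add) (intro fraction_eqI, auto simp: l_minus l_neg)
    then show "\<exists>y\<in>carrier ?L. y \<oplus>\<^bsub>?L\<^esub> x = \<zero>\<^bsub>?L\<^esub>"
      using x fraction_in_carrier by (metis a_inv_closed)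
  qed (simp add: localization_zero fraction_in_carrier)
  show "comm_monoid ?L"
  proof (rule comm_monoidI)
    fix x y z assume "x \<in> carrier ?L" "y \<in> carrier ?L" "z \<in> carrier ?L"
    then obtain a s b t c q where x: "x = fraction R U a s" "a \<in> carrier R" "s \<in> U"
      and y: "y = fraction R U b t" "b \<in> carrier R" "t \<in> U"
      and z: "z = fraction R U c q" "c \<in> carrier R" "q \<in> U"
      using elem by metis
    show "x \<otimes>\<^bsub>?L\<^esub> y \<otimes>\<^bsub>?L\<^esub> z = x \<otimes>\<^bsub>?L\<^esub> (y \<otimes>\<^bsub>?L\<^esub> z)"
      using x(2,3) y(2,3) z(2,3) unfolding x(1) y(1) z(1) by (simp add: fraction_mult m_ac)
  next
    fix x y assume "x \<in> carrier ?L" "y \<in> carrier ?L"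
    then obtain a s b t where x: "x = fraction R U a s" "a \<in> carrier R" "s \<in> U"
      and y: "y = fraction R U b t" "b \<in> carrier R" "t \<in> U"
      using elem by metis
    show "x \<otimes>\<^bsub>?L\<^esub> y \<in> carrier ?L"
      using x(2,3) y(2,3) unfolding x(1) y(1) by (simp add: fraction_mult fraction_in_carrier)
    show "x \<otimes>\<^bsub>?L\<^esub> y = y \<otimes>\<^bsub>?L\<^esub> x"
      using x(2,3) y(2,3) unfolding x(1) y(1) by (simp add: fraction_mult m_ac)
  next
    fix x assume "x \<in> carrier ?L"
    then obtain a s where x: "x = fraction R U a s" "a \<in> carrier R" "s \<in> U"
      using elem by metis
    show "\<one>\<^bsub>?L\<^esub> \<otimes>\<^bsub>?L\<^esub> x = x"
      using x(2,3) unfolding x(1) localization_one by (simp add: fraction_mult)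
  qed (simp add: localization_one fraction_in_carrier)
  fix x y z assume "x \<in> carrier ?L" "y \<in> carrier ?L" "z \<in> carrier ?L"
  then obtain a s b t c q where x: "x = fraction R U a s" "a \<in> carrier R" "s \<in> U"
    and y: "y = fraction R U b t" "b \<in> carrier R" "t \<in> U"
    and z: "z = fraction R U c q" "c \<in> carrier R" "q \<in> U"
    using elem by metis
  show "(x \<oplus>\<^bsub>?L\<^esub> y) \<otimes>\<^bsub>?L\<^esub> z = x \<otimes>\<^bsub>?L\<^esub> z \<oplus>\<^bsub>?L\<^esub> y \<otimes>\<^bsub>?L\<^esub> z"
    using x(2,3) y(2,3) z(2,3) unfolding x(1) y(1) z(1)
    by (simp add: fraction_add fraction_mult) (intro fraction_eqI, auto simp: l_distr r_distr m_ac)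
qed

end

text \<open>These three conditions determine the ring of fractions up to isomorphism:
  \<open>U\<close> becomes invertible, every element is a fraction, and only elements killed by some
  member of \<open>U\<close> vanish. Working from them avoids equivalence classes and treats A_S and
  the total quotient ring at once.\<close>

locale localization_map = ring_hom_cring R T h + U: submonoid U R
  for R (structure) and T (structure) and h and U +
  assumes unit: "u \<in> U \<Longrightarrow> \<exists>v\<in>carrier T. h u \<otimes>\<^bsub>T\<^esub> v = \<one>\<^bsub>T\<^esub>"
    and fraction: "x \<in> carrier T \<Longrightarrow> \<exists>a\<in>carrier R. \<exists>u\<in>U. h u \<otimes>\<^bsub>T\<^esub> x = h a"
    and kernel: "\<lbrakk>a \<in> carrier R; h a = \<zero>\<^bsub>T\<^esub>\<rbrakk> \<Longrightarrow> \<exists>u\<in>U. u \<otimes> a = \<zero>"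

lemma (in fractions) localization_map_localization:
  "localization_map R (localization R U) (\<lambda>a. fraction R U a \<one>) U"
proof -
  let ?L = "localization R U"
  interpret L: cring ?L by (rule cring_localization)
  have "(\<lambda>a. fraction R U a \<one>) \<in> ring_hom R ?L"
    by (rule ring_hom_memI)
      (simp_all add: fraction_in_carrier fraction_mult fraction_add localization_one)
  then have hom: "ring_hom_cring R ?L (\<lambda>a. fraction R U a \<one>)"
    by (intro ring_hom_cring.intro ring_hom_cring_axioms.intro is_cring L.is_cring)
  show ?thesis
  proof (intro localization_map.intro hom U.submonoid_axioms localization_map_axioms.intro)
    fix u assume u: "u \<in> U"
    then have "fraction R U u \<one> \<otimes>\<^bsub>?L\<^esub> fraction R U \<one> u = \<one>\<^bsub>?L\<^esub>"
      by (simp add: fraction_mult localization_one) (intro fraction_eqI, auto)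
    then show "\<exists>v\<in>carrier ?L. fraction R U u \<one> \<otimes>\<^bsub>?L\<^esub> v = \<one>\<^bsub>?L\<^esub>"
      using u fraction_in_carrier by blast
  next
    fix x assume "x \<in> carrier ?L"
    then obtain a s where x: "x = fraction R U a s" "a \<in> carrier R" "s \<in> U"
      by (auto simp: localization_carrier)
    have "fraction R U s \<one> \<otimes>\<^bsub>?L\<^esub> x = fraction R U a \<one>"
      using x(2,3) unfolding x(1) by (simp add: fraction_mult) (intro fraction_eqI, auto simp: m_ac)
    then show "\<exists>a\<in>carrier R. \<exists>u\<in>U. fraction R U u \<one> \<otimes>\<^bsub>?L\<^esub> x = fraction R U a \<one>"
      using x by blast
  next
    fix a assume a: "a \<in> carrier R" "fraction R U a \<one> = \<zero>\<^bsub>?L\<^esub>"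
    then obtain u where "u \<in> U" "u \<otimes> (a \<otimes> \<one>) = u \<otimes> (\<zero> \<otimes> \<one>)"
      using fraction_eq_iff[of a \<one> \<zero> \<one>] by (auto simp: localization_zero)
    then show "\<exists>u\<in>U. u \<otimes> a = \<zero>" using a by auto
  qed
qed

section \<open>Extension of ideals to a ring of fractions\<close>

context localization_map
begin

lemma U_carrier [simp]: "u \<in> U \<Longrightarrow> u \<in> carrier R"
  using U.subset by blast

lemma hom_cancel:
  assumes "u \<in> U" "x \<in> carrier T" "y \<in> carrier T" "h u \<otimes>\<^bsub>T\<^esub> x = h u \<otimes>\<^bsub>T\<^esub> y"
  shows "x = y"
proof -
  obtain v where v: "v \<in> carrier T" "h u \<otimes>\<^bsub>T\<^esub> v = \<one>\<^bsub>T\<^esub>" using unit assms(1) by blast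
  have "v \<otimes>\<^bsub>T\<^esub> h u = \<one>\<^bsub>T\<^esub>" using v assms(1) by (simp add: S.m_comm)
  then have "x = v \<otimes>\<^bsub>T\<^esub> (h u \<otimes>\<^bsub>T\<^esub> x)" "y = v \<otimes>\<^bsub>T\<^esub> (h u \<otimes>\<^bsub>T\<^esub> y)"
    using v assms(1-3) by (simp_all flip: S.m_assoc)
  then show ?thesis using assms(4) by simp
qed

lemma hom_divide:
  assumes "u \<in> U" "y \<in> carrier T"
  obtains x where "x \<in> carrier T" "h u \<otimes>\<^bsub>T\<^esub> x = y"
proof -
  obtain v where v: "v \<in> carrier T" "h u \<otimes>\<^bsub>T\<^esub> v = \<one>\<^bsub>T\<^esub>" using unit assms(1) by blast
  then have "h u \<otimes>\<^bsub>T\<^esub> (v \<otimes>\<^bsub>T\<^esub> y) = y" using assms by (simp flip: S.m_assoc)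
  then show ?thesis using v assms by (intro that[of "v \<otimes>\<^bsub>T\<^esub> y"]) auto
qed

lemma hom_eqD:
  assumes "a \<in> carrier R" "b \<in> carrier R" "h a = h b"
  shows "\<exists>u\<in>U. u \<otimes> a = u \<otimes> b"
proof -
  have "h (a \<ominus> b) = \<zero>\<^bsub>T\<^esub>"
    using assms by (simp add: R.minus_eq S.r_neg)
  then obtain u where u: "u \<in> U" "u \<otimes> (a \<ominus> b) = \<zero>" using kernel[of "a \<ominus> b"] assms by auto
  have "u \<otimes> a \<ominus> u \<otimes> b = u \<otimes> (a \<ominus> b)" using u(1) assms by (simp add: R.minus_eq R.r_distr R.r_minus)
  then have "u \<otimes> a = u \<otimes> b" using u assms by simp
  then show ?thesis using u(1) by blast
qed

text \<open>This is the extended ideal I T. Common denominators make each of its elements a single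
  fraction a/u with a in \<open>I\<close>, so no sums are needed; writing
  \<open>h u \<otimes> x = h a\<close> avoids inverses.\<close>

definition ext :: "'a set \<Rightarrow> 'c set" where
  "ext I = {x \<in> carrier T. \<exists>u\<in>U. \<exists>a\<in>I. h u \<otimes>\<^bsub>T\<^esub> x = h a}"

lemma extI: "x \<in> carrier T \<Longrightarrow> u \<in> U \<Longrightarrow> a \<in> I \<Longrightarrow> h u \<otimes>\<^bsub>T\<^esub> x = h a \<Longrightarrow> x \<in> ext I"
  unfolding ext_def by blast

lemma extE:
  assumes "x \<in> ext I"
  obtains u a where "x \<in> carrier T" "u \<in> U" "a \<in> I" "h u \<otimes>\<^bsub>T\<^esub> x = h a"
  using assms unfolding ext_def by blast

lemma hom_in_ext: "I \<subseteq> carrier R \<Longrightarrow> a \<in> I \<Longrightarrow> h a \<in> ext I"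
  by (rule extI[of _ \<one> a]) auto

lemma ideal_ext:
  assumes "ideal I R"
  shows "ideal (ext I) T"
proof -
  interpret I: ideal I R by fact
  show ?thesis
  proof (rule S.idealI_cring)
    show "ext I \<subseteq> carrier T" by (auto simp: ext_def)
    show "\<zero>\<^bsub>T\<^esub> \<in> ext I" using hom_in_ext[OF I.a_subset I.zero_closed] by simp
  next
    fix x y assume "x \<in> ext I" "y \<in> ext I"
    then obtain u a w b where x: "x \<in> carrier T" "u \<in> U" "a \<in> I" "h u \<otimes>\<^bsub>T\<^esub> x = h a"
      and y: "y \<in> carrier T" "w \<in> U" "b \<in> I" "h w \<otimes>\<^bsub>T\<^esub> y = h b" by (metis extE)
    have c: "a \<in> carrier R" "b \<in> carrier R" using x y I.Icarr by auto
    have "h (u \<otimes> w) \<otimes>\<^bsub>T\<^esub> (x \<oplus>\<^bsub>T\<^esub> y)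
        = h w \<otimes>\<^bsub>T\<^esub> (h u \<otimes>\<^bsub>T\<^esub> x) \<oplus>\<^bsub>T\<^esub> h u \<otimes>\<^bsub>T\<^esub> (h w \<otimes>\<^bsub>T\<^esub> y)"
      using x(1,2) y(1,2) by (simp add: S.r_distr S.m_ac)
    also have "\<dots> = h (w \<otimes> a \<oplus> u \<otimes> b)" using x y c by simp
    finally show "x \<oplus>\<^bsub>T\<^esub> y \<in> ext I"
      using x y by (intro extI[of _ "u \<otimes> w" "w \<otimes> a \<oplus> u \<otimes> b"]) (auto simp: I.I_l_closed)
  next
    fix x z assume "x \<in> ext I" "z \<in> carrier T"
    then obtain u a w b where x: "x \<in> carrier T" "u \<in> U" "a \<in> I" "h u \<otimes>\<^bsub>T\<^esub> x = h a"
      and z: "z \<in> carrier T" "w \<in> U" "b \<in> carrier R" "h w \<otimes>\<^bsub>T\<^esub> z = h b"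
      using fraction by (metis extE)
    have c: "a \<in> carrier R" using x I.Icarr by auto
    have "h (u \<otimes> w) \<otimes>\<^bsub>T\<^esub> (z \<otimes>\<^bsub>T\<^esub> x) = (h w \<otimes>\<^bsub>T\<^esub> z) \<otimes>\<^bsub>T\<^esub> (h u \<otimes>\<^bsub>T\<^esub> x)"
      using x(1,2) z(1,2) by (simp add: S.m_ac)
    also have "\<dots> = h (b \<otimes> a)" using x z c by simp
    finally show "z \<otimes>\<^bsub>T\<^esub> x \<in> ext I"
      using x z by (intro extI[of _ "u \<otimes> w" "b \<otimes> a"]) (auto simp: I.I_l_closed)
  qed
qed

text \<open>Multiply by the inverse of the unit \<open>h u\<close>.\<close>

lemma ideal_divide:
  assumes "ideal L T" "u \<in> U" "x \<in> carrier T" "h u \<otimes>\<^bsub>T\<^esub> x \<in> L"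
  shows "x \<in> L"
proof -
  obtain v where v: "v \<in> carrier T" "h u \<otimes>\<^bsub>T\<^esub> v = \<one>\<^bsub>T\<^esub>" using unit assms(2) by blast
  have "v \<otimes>\<^bsub>T\<^esub> h u = \<one>\<^bsub>T\<^esub>" using v assms(2) by (simp add: S.m_comm)
  then have "x = v \<otimes>\<^bsub>T\<^esub> (h u \<otimes>\<^bsub>T\<^esub> x)" using v assms(2,3) by (simp flip: S.m_assoc)
  then show ?thesis using ideal.I_l_closed[OF assms(1,4) v(1)] by simp
qed

lemma ext_subset_ideal:
  assumes "ideal L T" "\<And>a. a \<in> I \<Longrightarrow> h a \<in> L"
  shows "ext I \<subseteq> L"
  using assms ideal_divide by (metis extE subsetI)

text \<open>Clearing the denominator of an element of \<open>L\<close> gives a numerator whose image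
  is still in \<open>L\<close>. Hence a factorization of the contraction extends to one of
  \<open>L\<close>.\<close>

lemma ext_contraction:
  assumes "ideal L T"
  shows "ext {a \<in> carrier R. h a \<in> L} = L"
proof
  show "L \<subseteq> ext {a \<in> carrier R. h a \<in> L}"
  proof
    fix x assume x: "x \<in> L"
    then have xc: "x \<in> carrier T" using ideal.Icarr[OF assms] by blast
    then obtain a u where a: "a \<in> carrier R" "u \<in> U" "h u \<otimes>\<^bsub>T\<^esub> x = h a" using fraction by blast
    then have "h a \<in> L" using ideal.I_l_closed[OF assms x, of "h u"] by simp
    then show "x \<in> ext {a \<in> carrier R. h a \<in> L}" using a xc by (auto intro: extI)
  qed
qed (rule ext_subset_ideal[OF assms], simp)

lemma ext_ideal_prod:
  assumes "ideal I R" "ideal J R"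
  shows "ext (ideal_prod R I J) = ideal_prod T (ext I) (ext J)"
proof
  interpret I: ideal I R by fact
  interpret J: ideal J R by fact
  have p: "ideal (ideal_prod T (ext I) (ext J)) T"
    using S.ideal_prod_is_ideal ideal_ext assms by blast
  have q: "ideal (ideal_prod R I J) R" "ideal (ext (ideal_prod R I J)) T"
    using R.ideal_prod_is_ideal ideal_ext assms by blast+
  show "ext (ideal_prod R I J) \<subseteq> ideal_prod T (ext I) (ext J)"
  proof (rule ext_subset_ideal[OF p])
    fix a assume "a \<in> ideal_prod R I J"
    then show "h a \<in> ideal_prod T (ext I) (ext J)"
    proof induction
      case (prod i j)
      then show ?case using hom_in_ext I.a_subset J.a_subset I.Icarr J.Icarr
        by (auto intro: ideal_prod.prod)
    next
      case (sum a b)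
      then show ?case using ideal.Icarr[OF q(1)] by (auto intro: ideal_prod.sum)
    qed
  qed
  show "ideal_prod T (ext I) (ext J) \<subseteq> ext (ideal_prod R I J)"
  proof
    fix x assume "x \<in> ideal_prod T (ext I) (ext J)"
    then show "x \<in> ext (ideal_prod R I J)"
    proof induction
      case (prod x y)
      then obtain u a w b where x: "x \<in> carrier T" "u \<in> U" "a \<in> I" "h u \<otimes>\<^bsub>T\<^esub> x = h a"
        and y: "y \<in> carrier T" "w \<in> U" "b \<in> J" "h w \<otimes>\<^bsub>T\<^esub> y = h b" by (metis extE)
      have "h (u \<otimes> w) \<otimes>\<^bsub>T\<^esub> (x \<otimes>\<^bsub>T\<^esub> y) = (h u \<otimes>\<^bsub>T\<^esub> x) \<otimes>\<^bsub>T\<^esub> (h w \<otimes>\<^bsub>T\<^esub> y)"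
        using x(1,2) y(1,2) by (simp add: S.m_ac)
      also have "\<dots> = h (a \<otimes> b)" using x y I.Icarr J.Icarr by simp
      finally show ?case
        using x y by (intro extI[of _ "u \<otimes> w" "a \<otimes> b"]) (auto intro: ideal_prod.prod)
    next
      case (sum x y)
      then show ?case
        using additive_subgroup.a_closed[OF ideal.axioms(1)[OF q(2)]] by blast
    qed
  qed
qed

lemma ext_PIdl:
  assumes "a \<in> carrier R"
  shows "ext (PIdl a) = PIdl\<^bsub>T\<^esub> (h a)"
proof
  have "ideal (PIdl\<^bsub>T\<^esub> (h a)) T" using assms by (simp add: S.cgenideal_ideal)
  then show "ext (PIdl a) \<subseteq> PIdl\<^bsub>T\<^esub> (h a)"
    by (rule ext_subset_ideal) (use assms in \<open>auto simp: cgenideal_def\<close>)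
  have "h a \<in> ext (PIdl a)"
    using assms R.cgenideal_self[OF assms] by (intro hom_in_ext) (auto simp: cgenideal_def)
  then show "PIdl\<^bsub>T\<^esub> (h a) \<subseteq> ext (PIdl a)"
    using S.cgenideal_minimal ideal_ext[OF R.cgenideal_ideal[OF assms]] by blast
qed

text \<open>If (r/1)(a/u) = 0, then w r a = 0 for some w in \<open>U\<close>; regularity of r gives
  w a = 0, that is a/u = 0.\<close>

lemma regular_hom:
  assumes "r \<in> regular_elements R"
  shows "h r \<in> regular_elements T"
proof -
  have r: "r \<in> carrier R" "\<And>x. x \<in> carrier R \<Longrightarrow> r \<otimes> x = \<zero> \<Longrightarrow> x = \<zero>"
    using assms by (auto simp: regular_elements_def)
  have "x = \<zero>\<^bsub>T\<^esub>" if x: "x \<in> carrier T" "h r \<otimes>\<^bsub>T\<^esub> x = \<zero>\<^bsub>T\<^esub>" for x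
  proof -
    obtain a u where a: "a \<in> carrier R" "u \<in> U" "h u \<otimes>\<^bsub>T\<^esub> x = h a" using fraction x by blast
    have "h (r \<otimes> a) = h r \<otimes>\<^bsub>T\<^esub> (h u \<otimes>\<^bsub>T\<^esub> x)" using a r(1) by simp
    also have "\<dots> = h u \<otimes>\<^bsub>T\<^esub> (h r \<otimes>\<^bsub>T\<^esub> x)" using a(1,2) x(1) r(1) by (simp add: S.m_ac)
    finally have "h (r \<otimes> a) = \<zero>\<^bsub>T\<^esub>" using x a by simp
    then obtain w where w: "w \<in> U" "w \<otimes> (r \<otimes> a) = \<zero>" using kernel[of "r \<otimes> a"] r(1) a(1) by auto
    have "r \<otimes> (w \<otimes> a) = w \<otimes> (r \<otimes> a)" using r(1) a(1) w(1) by (simp add: R.m_ac)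
    then have "w \<otimes> a = \<zero>" using r(2)[of "w \<otimes> a"] w a(1) by simp
    then have "h w \<otimes>\<^bsub>T\<^esub> h a = \<zero>\<^bsub>T\<^esub>" using w(1) a(1) by (metis U_carrier hom_mult hom_zero)
    then have "h a = \<zero>\<^bsub>T\<^esub>" using hom_cancel[OF w(1), of "h a" "\<zero>\<^bsub>T\<^esub>"] a(1) w(1) by simp
    then show ?thesis using hom_cancel[OF a(2) x(1), of "\<zero>\<^bsub>T\<^esub>"] a(2,3) by simp
  qed
  then show ?thesis using r(1) by (simp add: regular_elements_def)
qed

end

section \<open>Invertible ideals\<close>

lemma regular_elementsD:
  "r \<in> regular_elements R \<Longrightarrow> x \<in> carrier R \<Longrightarrow> r \<otimes>\<^bsub>R\<^esub> x = \<zero>\<^bsub>R\<^esub> \<Longrightarrow> x = \<zero>\<^bsub>R\<^esub>"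
  by (simp add: regular_elements_def)

lemma regular_elements_carrier: "r \<in> regular_elements R \<Longrightarrow> r \<in> carrier R"
  by (simp add: regular_elements_def)

lemma regular_elementsI:
  "r \<in> carrier R \<Longrightarrow> (\<And>x. x \<in> carrier R \<Longrightarrow> r \<otimes>\<^bsub>R\<^esub> x = \<zero>\<^bsub>R\<^esub> \<Longrightarrow> x = \<zero>\<^bsub>R\<^esub>) \<Longrightarrow>
    r \<in> regular_elements R"
  by (simp add: regular_elements_def)

lemma (in cring) regular_submonoid: "submonoid (regular_elements R) R"
proof (rule submonoid.intro)
  fix r s assume r: "r \<in> regular_elements R" and s: "s \<in> regular_elements R"
  show "r \<otimes> s \<in> regular_elements R"
  proof (rule regular_elementsI)
    fix x assume x: "x \<in> carrier R" "r \<otimes> s \<otimes> x = \<zero>"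
    note c = regular_elements_carrier[OF r] regular_elements_carrier[OF s]
    have "r \<otimes> (s \<otimes> x) = \<zero>" using x c by (simp add: m_assoc)
    then have "s \<otimes> x = \<zero>"
      using regular_elementsD[OF r] c x(1) by blast
    then show "x = \<zero>" using regular_elementsD[OF s] x(1) by blast
  qed (use regular_elements_carrier[OF r] regular_elements_carrier[OF s] in simp)
next
  show "\<one> \<in> regular_elements R" by (rule regular_elementsI) simp_all
qed (auto dest: regular_elements_carrier)

text \<open>From here on the total quotient ring is seen only through the abstract interface, with
  the regular elements as denominators.\<close>

lemma (in cring) localization_map_total_quotient:
  "localization_map R (total_quotient_ring R) (to_total_quotient R) (regular_elements R)"
proof -
  interpret fractions R "regular_elements R"
    by (intro fractions.intro is_cring regular_submonoid)
  have "to_total_quotient R = (\<lambda>a. fraction R (regular_elements R) a \<one>)"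
    by (rule ext) (rule to_total_quotient_def)
  then show ?thesis
    unfolding total_quotient_ring_def by (simp only: localization_map_localization)
qed

lemma (in ring) ideal_prod_mono:
  "I \<subseteq> I' \<Longrightarrow> J \<subseteq> J' \<Longrightarrow> ideal_prod R I J \<subseteq> ideal_prod R I' J'"
proof
  fix x assume s: "I \<subseteq> I'" "J \<subseteq> J'" and "x \<in> ideal_prod R I J"
  from this(3) show "x \<in> ideal_prod R I' J'"
  proof induction
    case (prod i j)
    then show ?case using s by (intro ideal_prod.prod) auto
  qed (rule ideal_prod.sum)
qed

text \<open>Used to pass to a larger common denominator. Membership of \<open>x\<close> in the
  carrier is carried along because distributivity in the sum step requires it.\<close>

lemma (in cring) ideal_prod_scale:
  assumes "x \<in> ideal_prod R J K" "c \<in> carrier R" "J \<subseteq> carrier R" "K \<subseteq> carrier R"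
  shows "c \<otimes> x \<in> ideal_prod R J ((\<lambda>k. c \<otimes> k) ` K) \<and> x \<in> carrier R"
  using assms(1)
proof induction
  case (prod i j)
  then have "c \<otimes> (i \<otimes> j) = i \<otimes> (c \<otimes> j)" using assms by (auto simp: m_ac subset_iff)
  then show ?case using prod assms by (auto intro: ideal_prod.prod)
next
  case (sum x y)
  then show ?case using assms by (auto simp: r_distr intro: ideal_prod.sum)
qed

section \<open>Invertibility expressed without the total quotient ring\<close>

lemma subgroup_total_quotient_module:
  "subgroup H (add_monoid (total_quotient_module R)) \<longleftrightarrow>
    subgroup H (add_monoid (total_quotient_ring R))"
  by (simp add: total_quotient_module_def ring.extend_def subgroup_def m_inv_def)

lemma smult_total_quotient_module:
  "a \<odot>\<^bsub>total_quotient_module R\<^esub> x = to_total_quotient R a \<otimes>\<^bsub>total_quotient_ring R\<^esub> x"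
  by (simp add: total_quotient_module_def ring.extend_def)

locale total_quotient_map = localization_map R T h "regular_elements R"
  for R (structure) and T (structure) and h

text \<open>From J J' = R, the unit is a finite sum of products j x; if u is a common denominator of
  the x, then K = u J' \<inter> R satisfies J K = (u). Conversely, J' = K / r is an inverse of
  \<open>J\<close> when J K = (r).\<close>

lemma (in total_quotient_map) invertible_submodule_iff:
  assumes "ideal J R"
  shows "(\<exists>J'. subgroup J' (add_monoid T) \<and>
      (\<forall>a\<in>carrier R. \<forall>x\<in>J'. h a \<otimes>\<^bsub>T\<^esub> x \<in> J') \<and> ideal_prod T (h ` J) J' = h ` carrier R) \<longleftrightarrow>
    (\<exists>K r. ideal K R \<and> r \<in> regular_elements R \<and> ideal_prod R J K = PIdl r)"
    (is "?submodule \<longleftrightarrow> ?principal")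
proof -
  interpret J: ideal J R by fact
  \<comment> \<open>Equality of images means equality after multiplication by a regular element, so
    \<open>h\<close> embeds \<open>R\<close> into its total quotient ring.\<close>
  have inj: "a = b" if ab: "a \<in> carrier R" "b \<in> carrier R" "h a = h b" for a b
  proof -
    obtain u where u: "u \<in> regular_elements R" "u \<otimes> a = u \<otimes> b" using hom_eqD[OF ab] by blast
    then have "u \<otimes> (a \<ominus> b) = \<zero>" using ab(1,2) by (simp add: R.minus_eq R.r_distr R.r_minus R.r_neg)
    then have "a \<ominus> b = \<zero>"
      using regular_elementsD[of u R "a \<ominus> b"] u(1) ab(1,2) by simp
    then show ?thesis using ab(1,2) by simp
  qed
  show ?thesis
  proof
    assume ?submodule
    then obtain J' where J': "subgroup J' (add_monoid T)"
      "\<And>a x. a \<in> carrier R \<Longrightarrow> x \<in> J' \<Longrightarrow> h a \<otimes>\<^bsub>T\<^esub> x \<in> J'"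
      "ideal_prod T (h ` J) J' = h ` carrier R"
      by blast
    have J'c: "\<And>x. x \<in> J' \<Longrightarrow> x \<in> carrier T" using subgroup.mem_carrier[OF J'(1)] by simp
    have J'add: "\<And>x y. x \<in> J' \<Longrightarrow> y \<in> J' \<Longrightarrow> x \<oplus>\<^bsub>T\<^esub> y \<in> J'"
      using subgroup.m_closed[OF J'(1)] by simp
    have J'0: "\<zero>\<^bsub>T\<^esub> \<in> J'" using subgroup.one_closed[OF J'(1)] by simp
    \<comment> \<open>\<open>K u\<close> is u J' \<inter> R. It is a function of \<open>u\<close>
      because the common denominator is known only after the induction below.\<close>
    define K where "K u = {k \<in> carrier R. \<exists>x\<in>J'. h k = h u \<otimes>\<^bsub>T\<^esub> x}" for u
    have K_ideal: "ideal (K u) R" if u: "u \<in> regular_elements R" for u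
    proof (rule R.idealI_cring)
      show "K u \<subseteq> carrier R" by (auto simp: K_def)
      show "\<zero> \<in> K u" using u J'0 by (auto simp: K_def intro!: bexI[of _ "\<zero>\<^bsub>T\<^esub>"])
      fix x y assume "x \<in> K u" "y \<in> K u"
      then obtain x' y' where "x \<in> carrier R" "y \<in> carrier R" "x' \<in> J'" "y' \<in> J'"
        "h x = h u \<otimes>\<^bsub>T\<^esub> x'" "h y = h u \<otimes>\<^bsub>T\<^esub> y'" by (auto simp: K_def)
      then show "x \<oplus> y \<in> K u" using u J'add J'c
        by (auto simp: K_def S.r_distr intro!: bexI[of _ "x' \<oplus>\<^bsub>T\<^esub> y'"])
    next
      fix x a assume "x \<in> K u" and a: "a \<in> carrier R"
      then obtain x' where "x \<in> carrier R" "x' \<in> J'" "h x = h u \<otimes>\<^bsub>T\<^esub> x'" by (auto simp: K_def)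
      then show "a \<otimes> x \<in> K u" using u J'(2) J'c a
        by (auto simp: K_def S.m_ac intro!: bexI[of _ "h a \<otimes>\<^bsub>T\<^esub> x'"])
    qed
    have K_scale: "(\<lambda>k. c \<otimes> k) ` K u \<subseteq> K (c \<otimes> u)" if "c \<in> regular_elements R" "u \<in> regular_elements R" for c u
      using that J'c by (auto simp: K_def S.m_assoc)
    \<comment> \<open>The common denominator is built along the finite sum: each product contributes
      its own \<open>u\<close>, and adding two terms multiplies their denominators, with
      \<open>K_scale\<close> moving both numerators into the new ideal.\<close>
    have "\<exists>u\<in>regular_elements R. \<exists>w\<in>ideal_prod R J (K u). h u \<otimes>\<^bsub>T\<^esub> z = h w"
      if "z \<in> ideal_prod T (h ` J) J'" for z
      using that
    proof induction
      case (prod i x)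
      then obtain j where j: "j \<in> J" "i = h j" by blast
      obtain a u where a: "a \<in> carrier R" "u \<in> regular_elements R" "h u \<otimes>\<^bsub>T\<^esub> x = h a"
        using fraction J'c prod by blast
      have "a \<in> K u" using a prod by (auto simp: K_def intro!: bexI[of _ x])
      moreover have "h u \<otimes>\<^bsub>T\<^esub> (i \<otimes>\<^bsub>T\<^esub> x) = h (j \<otimes> a)"
      proof -
        have "h u \<otimes>\<^bsub>T\<^esub> (i \<otimes>\<^bsub>T\<^esub> x) = i \<otimes>\<^bsub>T\<^esub> (h u \<otimes>\<^bsub>T\<^esub> x)"
          using j prod J'c J.Icarr a(1,2) by (simp add: S.m_ac)
        then show ?thesis using a j J.Icarr by simp
      qed
      ultimately show ?case using a j by (blast intro: ideal_prod.prod)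
    next
      case (sum x y)
      then obtain u w v z where
        x: "u \<in> regular_elements R" "w \<in> ideal_prod R J (K u)" "h u \<otimes>\<^bsub>T\<^esub> x = h w" and
        y: "v \<in> regular_elements R" "z \<in> ideal_prod R J (K v)" "h v \<otimes>\<^bsub>T\<^esub> y = h z" by blast
      have c: "w \<in> carrier R" "z \<in> carrier R"
        using x y R.ideal_prod_in_carrier[OF assms K_ideal] by blast+
      have xyc: "x \<in> carrier T" "y \<in> carrier T" using sum J'(3) by auto
      have Kc: "K u \<subseteq> carrier R" for u by (auto simp: K_def)
      have "v \<otimes> w \<in> ideal_prod R J (K (u \<otimes> v))"
        using R.ideal_prod_scale[OF x(2), of v] K_scale[of v u] R.ideal_prod_mono[OF subset_refl] x y Kc
          J.a_subset by (metis U_carrier R.m_comm subset_iff)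
      moreover have "u \<otimes> z \<in> ideal_prod R J (K (u \<otimes> v))"
        using R.ideal_prod_scale[OF y(2), of u] K_scale[of u v] R.ideal_prod_mono[OF subset_refl] x y Kc
          J.a_subset by (metis U_carrier subset_iff)
      ultimately have "v \<otimes> w \<oplus> u \<otimes> z \<in> ideal_prod R J (K (u \<otimes> v))" by (rule ideal_prod.sum)
      moreover have "h (u \<otimes> v) \<otimes>\<^bsub>T\<^esub> (x \<oplus>\<^bsub>T\<^esub> y) = h (v \<otimes> w \<oplus> u \<otimes> z)"
      proof -
        have "h (u \<otimes> v) \<otimes>\<^bsub>T\<^esub> (x \<oplus>\<^bsub>T\<^esub> y)
            = h v \<otimes>\<^bsub>T\<^esub> (h u \<otimes>\<^bsub>T\<^esub> x) \<oplus>\<^bsub>T\<^esub> h u \<otimes>\<^bsub>T\<^esub> (h v \<otimes>\<^bsub>T\<^esub> y)"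
          using x(1) y(1) xyc by (simp add: S.r_distr S.m_ac)
        then show ?thesis using x y c by simp
      qed
      ultimately show ?case using x y by blast
    qed
    \<comment> \<open>Taking z = 1 gives h u = h w, so injectivity puts \<open>u\<close> itself into
      J K(u).\<close>
    moreover have "\<one>\<^bsub>T\<^esub> \<in> ideal_prod T (h ` J) J'" unfolding J'(3) using hom_one by (metis imageI R.one_closed)
    ultimately obtain u w where u: "u \<in> regular_elements R" "w \<in> ideal_prod R J (K u)" "h u = h w"
      by (metis S.r_one U_carrier hom_closed)
    have JK: "ideal (ideal_prod R J (K u)) R" by (rule R.ideal_prod_is_ideal[OF assms K_ideal[OF u(1)]])
    have "u = w" using inj u ideal.Icarr[OF JK] by simp
    then have "PIdl u \<subseteq> ideal_prod R J (K u)" using R.cgenideal_minimal[OF JK] u by simp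
    \<comment> \<open>For k = u x with x in \<open>J'\<close>, the product j k is u (j x), and j x
      lies in J J' = R.\<close>
    moreover have "ideal_prod R J (K u) \<subseteq> PIdl u"
    proof
      have P: "ideal (PIdl u) R" using R.cgenideal_ideal u by simp
      fix x assume "x \<in> ideal_prod R J (K u)"
      then show "x \<in> PIdl u"
      proof induction
        case (prod j k)
        then obtain x where x: "k \<in> carrier R" "x \<in> J'" "h k = h u \<otimes>\<^bsub>T\<^esub> x" by (auto simp: K_def)
        have "h j \<otimes>\<^bsub>T\<^esub> x \<in> h ` carrier R"
          using prod x unfolding J'(3)[symmetric] by (auto intro: ideal_prod.prod)
        then obtain a where a: "a \<in> carrier R" "h j \<otimes>\<^bsub>T\<^esub> x = h a" by blast
        have "h (j \<otimes> k) = h u \<otimes>\<^bsub>T\<^esub> (h j \<otimes>\<^bsub>T\<^esub> x)"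
          using prod(1) x J.Icarr J'c u(1) by (simp add: S.m_ac)
        then have "h (j \<otimes> k) = h (a \<otimes> u)" using a u(1) by (simp add: S.m_comm)
        then have "j \<otimes> k = a \<otimes> u" using inj a(1) u(1) x(1) prod(1) J.Icarr by simp
        then show ?case using a by (auto simp: cgenideal_def)
      next
        case (sum x y)
        then show ?case using additive_subgroup.a_closed[OF ideal.axioms(1)[OF P]] by blast
      qed
    qed
    ultimately show ?principal using K_ideal[OF u(1)] u(1) by blast
  next
    assume ?principal
    then obtain K r where K: "ideal K R" "r \<in> regular_elements R" "ideal_prod R J K = PIdl r" by blast
    interpret K: ideal K R by fact
    \<comment> \<open>This is K / r inside \<open>T\<close>.\<close>
    define J' where "J' = {x \<in> carrier T. h r \<otimes>\<^bsub>T\<^esub> x \<in> h ` K}"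
    have J'I: "x \<in> J'" if "x \<in> carrier T" "k \<in> K" "h r \<otimes>\<^bsub>T\<^esub> x = h k" for x k
      using that by (simp add: J'_def)
    have sg: "subgroup J' (add_monoid T)"
    proof (rule group.subgroupI)
      show "group (add_monoid T)" using S.add.is_group .
      have "\<zero>\<^bsub>T\<^esub> \<in> J'" using K(2) K.zero_closed by (auto simp: J'_def intro!: image_eqI[of _ _ \<zero>])
      then show "J' \<noteq> {}" by blast
    next
      fix x assume "x \<in> J'"
      then obtain k where k: "x \<in> carrier T" "k \<in> K" "h r \<otimes>\<^bsub>T\<^esub> x = h k" by (auto simp: J'_def)
      then have "h r \<otimes>\<^bsub>T\<^esub> (\<ominus>\<^bsub>T\<^esub> x) = h (\<ominus> k)" using K K.Icarr by (simp add: S.r_minus)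
      then have "\<ominus>\<^bsub>T\<^esub> x \<in> J'" using J'I[of "\<ominus>\<^bsub>T\<^esub> x" "\<ominus> k"] k(1,2) K.a_inv_closed by simp
      then show "inv\<^bsub>add_monoid T\<^esub> x \<in> J'" by (simp only: a_inv_def)
    next
      fix x y assume "x \<in> J'" "y \<in> J'"
      then obtain k l where k: "x \<in> carrier T" "k \<in> K" "h r \<otimes>\<^bsub>T\<^esub> x = h k"
        and l: "y \<in> carrier T" "l \<in> K" "h r \<otimes>\<^bsub>T\<^esub> y = h l" by (auto simp: J'_def)
      then have "h r \<otimes>\<^bsub>T\<^esub> (x \<oplus>\<^bsub>T\<^esub> y) = h (k \<oplus> l)" using K K.Icarr by (simp add: S.r_distr)
      then show "x \<otimes>\<^bsub>add_monoid T\<^esub> y \<in> J'"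
        using J'I[of "x \<oplus>\<^bsub>T\<^esub> y" "k \<oplus> l"] k(1,2) l(1,2) by simp
    qed (auto simp: J'_def)
    have sm: "h a \<otimes>\<^bsub>T\<^esub> x \<in> J'" if ax: "a \<in> carrier R" "x \<in> J'" for a x
    proof -
      obtain k where k: "x \<in> carrier T" "k \<in> K" "h r \<otimes>\<^bsub>T\<^esub> x = h k" using ax by (auto simp: J'_def)
      have "h r \<otimes>\<^bsub>T\<^esub> (h a \<otimes>\<^bsub>T\<^esub> x) = h a \<otimes>\<^bsub>T\<^esub> (h r \<otimes>\<^bsub>T\<^esub> x)"
        using k(1) K(2) ax by (simp add: S.m_ac)
      then have "h r \<otimes>\<^bsub>T\<^esub> (h a \<otimes>\<^bsub>T\<^esub> x) = h (a \<otimes> k)" using ax k K.Icarr by simp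
      then show ?thesis using J'I[of _ "a \<otimes> k"] ax k(1,2) K.I_l_closed by simp
    qed
    have J'c: "\<And>x. x \<in> J' \<Longrightarrow> x \<in> carrier T" by (simp add: J'_def)
    have JKc: "\<And>w. w \<in> ideal_prod R J K \<Longrightarrow> w \<in> carrier R"
      using R.ideal_prod_in_carrier[OF assms K(1)] by blast
    \<comment> \<open>\<open>up\<close> and \<open>down\<close> say that multiplication by
      \<open>h r\<close> carries J J' onto the image of J K = (r). Cancelling \<open>h r\<close>
      then leaves J J' = R.\<close>
    have up: "z \<in> carrier T \<and> (\<exists>w\<in>ideal_prod R J K. h r \<otimes>\<^bsub>T\<^esub> z = h w)"
      if "z \<in> ideal_prod T (h ` J) J'" for z
      using that
    proof induction
      case (prod i x)
      then obtain j k where j: "j \<in> J" "i = h j" "k \<in> K" "h r \<otimes>\<^bsub>T\<^esub> x = h k" "x \<in> carrier T"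
        by (auto simp: J'_def)
      have "h r \<otimes>\<^bsub>T\<^esub> (i \<otimes>\<^bsub>T\<^esub> x) = i \<otimes>\<^bsub>T\<^esub> (h r \<otimes>\<^bsub>T\<^esub> x)"
        using j(1,2,5) K(2) J.Icarr by (simp add: S.m_ac)
      then have "h r \<otimes>\<^bsub>T\<^esub> (i \<otimes>\<^bsub>T\<^esub> x) = h (j \<otimes> k)" using j J.Icarr K.Icarr by simp
      moreover have "i \<otimes>\<^bsub>T\<^esub> x \<in> carrier T" using j(1,2,5) J.Icarr by simp
      ultimately show ?case using ideal_prod.prod[OF j(1,3), of R] by blast
    next
      case (sum x y)
      then obtain v w where v: "v \<in> ideal_prod R J K" "h r \<otimes>\<^bsub>T\<^esub> x = h v"
        and w: "w \<in> ideal_prod R J K" "h r \<otimes>\<^bsub>T\<^esub> y = h w" by blast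
      have "h r \<otimes>\<^bsub>T\<^esub> (x \<oplus>\<^bsub>T\<^esub> y) = h (v \<oplus> w)"
        using sum.IH v w K(2) JKc by (auto simp: S.r_distr)
      then show ?case using sum ideal_prod.sum[OF v(1) w(1)] by auto
    qed
    have down: "\<exists>z\<in>ideal_prod T (h ` J) J'. h r \<otimes>\<^bsub>T\<^esub> z = h w" if "w \<in> ideal_prod R J K" for w
      using that
    proof induction
      case (prod j k)
      obtain x where x: "x \<in> carrier T" "h r \<otimes>\<^bsub>T\<^esub> x = h k"
        using hom_divide[OF K(2)] prod K.Icarr hom_closed by metis
      have "x \<in> J'" using J'I x prod by blast
      moreover have "h r \<otimes>\<^bsub>T\<^esub> (h j \<otimes>\<^bsub>T\<^esub> x) = h (j \<otimes> k)"
      proof -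
        have "h r \<otimes>\<^bsub>T\<^esub> (h j \<otimes>\<^bsub>T\<^esub> x) = h j \<otimes>\<^bsub>T\<^esub> (h r \<otimes>\<^bsub>T\<^esub> x)"
          using x(1) prod K(2) J.Icarr by (simp add: S.m_ac)
        then show ?thesis using x prod J.Icarr K.Icarr by simp
      qed
      ultimately show ?case using prod by (blast intro: ideal_prod.prod)
    next
      case (sum v w)
      then obtain x y where x: "x \<in> ideal_prod T (h ` J) J'" "h r \<otimes>\<^bsub>T\<^esub> x = h v"
        and y: "y \<in> ideal_prod T (h ` J) J'" "h r \<otimes>\<^bsub>T\<^esub> y = h w" by blast
      have "h r \<otimes>\<^bsub>T\<^esub> (x \<oplus>\<^bsub>T\<^esub> y) = h (v \<oplus> w)"
        using x y up[OF x(1)] up[OF y(1)] K(2) JKc sum.hyps by (simp add: S.r_distr)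
      then show ?case using ideal_prod.sum[OF x(1) y(1)] by blast
    qed
    have "ideal_prod T (h ` J) J' = h ` carrier R"
    proof (intro subset_antisym subsetI)
      fix z assume "z \<in> ideal_prod T (h ` J) J'"
      then obtain w where w: "z \<in> carrier T" "w \<in> PIdl r" "h r \<otimes>\<^bsub>T\<^esub> z = h w" using up K by metis
      then obtain a where a: "a \<in> carrier R" "w = a \<otimes> r" by (auto simp: cgenideal_def)
      then have "h r \<otimes>\<^bsub>T\<^esub> z = h r \<otimes>\<^bsub>T\<^esub> h a" using w K(2) by (simp add: S.m_comm)
      then have "z = h a" using hom_cancel[OF K(2), of z "h a"] w(1) a(1) by simp
      then show "z \<in> h ` carrier R" using a by blast
    next
      fix z assume "z \<in> h ` carrier R"
      then obtain a where a: "a \<in> carrier R" "z = h a" by blast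
      then have "a \<otimes> r \<in> ideal_prod R J K" unfolding K(3) by (auto simp: cgenideal_def)
      then obtain y where y: "y \<in> ideal_prod T (h ` J) J'" "h r \<otimes>\<^bsub>T\<^esub> y = h (a \<otimes> r)" using down by blast
      then have "h r \<otimes>\<^bsub>T\<^esub> y = h r \<otimes>\<^bsub>T\<^esub> z" using a K(2) by (simp add: S.m_comm)
      then have "y = z" using hom_cancel[OF K(2), of y z] up[OF y(1)] a by simp
      then show "z \<in> ideal_prod T (h ` J) J'" using y by simp
    qed
    then show ?submodule using sg sm by blast
  qed
qed

text \<open>The working criterion: with it, images, extensions and products of invertible ideals are
  computed by transporting one equation between ideals.\<close>

lemma (in cring) invertible_ideal_iff:
  "invertible_ideal R J \<longleftrightarrow> ideal J R \<and>
    (\<exists>K r. ideal K R \<and> r \<in> regular_elements R \<and> ideal_prod R J K = PIdl r)"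
proof -
  interpret total_quotient_map R "total_quotient_ring R" "to_total_quotient R"
    by (rule total_quotient_map.intro) (rule localization_map_total_quotient)
  have sub_iff: "submodule J' R (total_quotient_module R) \<longleftrightarrow>
      subgroup J' (add_monoid (total_quotient_ring R)) \<and>
      (\<forall>a\<in>carrier R. \<forall>x\<in>J'. to_total_quotient R a \<otimes>\<^bsub>total_quotient_ring R\<^esub> x \<in> J')" for J'
    unfolding submodule_def submodule_axioms_def subgroup_total_quotient_module
      smult_total_quotient_module
    by (rule conj_cong[OF refl]) blast
  show ?thesis
    unfolding invertible_ideal_def sub_iff conj_assoc
    by (rule conj_cong[OF refl], rule invertible_submodule_iff)
qed

lemma (in cring) regular_cancel:
  assumes "r \<in> regular_elements R" "x \<in> carrier R" "y \<in> carrier R" "r \<otimes> x = r \<otimes> y"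
  shows "x = y"
proof -
  have "r \<otimes> (x \<ominus> y) = r \<otimes> x \<ominus> r \<otimes> y"
    using assms(2,3) regular_elements_carrier[OF assms(1)] by (simp add: minus_eq r_distr r_minus)
  also have "\<dots> = \<zero>" using assms regular_elements_carrier[OF assms(1)] by simp
  finally have "x \<ominus> y = \<zero>" using regular_elementsD[OF assms(1)] assms(2,3) by simp
  then show ?thesis using assms(2,3) by simp
qed

lemma (in cring) invertible_carrier: "invertible_ideal R (carrier R)"
proof -
  have "\<one> \<in> regular_elements R" by (rule regular_elementsI) simp_all
  moreover have "PIdl \<one> = carrier R"
    using ideal.one_imp_carrier cgenideal_ideal cgenideal_self by blast
  ultimately show ?thesis
    unfolding invertible_ideal_iff using oneideal ideal_prod_one[OF oneideal] by metis
qed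

text \<open>The element r of J K = (r) already lies in \<open>J\<close>.\<close>

lemma (in cring) invertible_regular_element:
  assumes "invertible_ideal R J"
  shows "\<exists>r\<in>J. r \<in> regular_elements R"
proof -
  obtain K r where J: "ideal J R" "ideal K R" "r \<in> regular_elements R" "ideal_prod R J K = PIdl r"
    using assms unfolding invertible_ideal_iff by blast
  have "r \<in> ideal_prod R J K"
    unfolding J(4) using J(3) by (intro cgenideal_self regular_elements_carrier)
  then show ?thesis using ideal_prod_inter[OF J(1,2)] J(3) by blast
qed

text \<open>
  The quotient of \<open>PIdl j\<close> by \<open>J\<close> is \<open>j K / r\<close>; in contrast to \<open>r\<close> itself, \<open>j\<close> may be any
  element of \<open>J\<close>, which is what survives passing to a residue ring in which \<open>r\<close> vanishes.
\<close>

lemma (in cring) invertible_divides_principal: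
  assumes "invertible_ideal R J" "j \<in> J"
  shows "\<exists>K. ideal K R \<and> ideal_prod R J K = PIdl j"
proof -
  obtain K r where J: "ideal J R" and K: "ideal K R" and r: "r \<in> regular_elements R"
    and JK: "ideal_prod R J K = PIdl r"
    using assms(1) unfolding invertible_ideal_iff by blast
  interpret J: ideal J R by fact
  interpret K: ideal K R by fact
  have rc: "r \<in> carrier R" using r by (rule regular_elements_carrier)
  have jc: "j \<in> carrier R" using assms(2) by (rule J.Icarr)
  \<comment> \<open>In particular every j l with l in \<open>K\<close> is a multiple of r, so
    dividing j K by r stays inside the ring.\<close>
  have JK_mult: "\<exists>c\<in>carrier R. a \<otimes> k = c \<otimes> r" if "a \<in> J" "k \<in> K" for a k
    using ideal_prod.prod[OF that, of R] unfolding JK by (auto simp: cgenideal_def)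
  define L where "L = {k \<in> carrier R. \<exists>l\<in>K. r \<otimes> k = j \<otimes> l}"
  have LI: "k \<in> L" if "k \<in> carrier R" "l \<in> K" "r \<otimes> k = j \<otimes> l" for k l
    unfolding L_def using that by blast
  have L: "ideal L R"
  proof (rule idealI_cring)
    show "L \<subseteq> carrier R" by (auto simp: L_def)
    show "\<zero> \<in> L" using rc jc by (intro LI[of \<zero> \<zero>]) auto
  next
    fix x y assume "x \<in> L" "y \<in> L"
    then obtain k l where x: "x \<in> carrier R" "k \<in> K" "r \<otimes> x = j \<otimes> k"
      and y: "y \<in> carrier R" "l \<in> K" "r \<otimes> y = j \<otimes> l" by (auto simp: L_def)
    then have "r \<otimes> (x \<oplus> y) = j \<otimes> (k \<oplus> l)" using rc jc K.Icarr by (simp add: r_distr)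
    then show "x \<oplus> y \<in> L" using LI[of "x \<oplus> y" "k \<oplus> l"] x(1,2) y(1,2) by simp
  next
    fix x a assume "x \<in> L" and a: "a \<in> carrier R"
    then obtain k where x: "x \<in> carrier R" "k \<in> K" "r \<otimes> x = j \<otimes> k" by (auto simp: L_def)
    have "r \<otimes> (a \<otimes> x) = a \<otimes> (r \<otimes> x)" using x(1) a rc by (simp add: m_ac)
    also have "\<dots> = j \<otimes> (a \<otimes> k)" using x a jc K.Icarr[OF x(2)] by (simp add: m_ac)
    finally show "a \<otimes> x \<in> L" using LI[of "a \<otimes> x" "a \<otimes> k"] x(1,2) a K.I_l_closed by simp
  qed
  interpret L: ideal L R by fact
  have JLc: "z \<in> carrier R" if "z \<in> ideal_prod R J L" for z
    using ideal_prod_in_carrier[OF J L] that by blast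
  have JKc: "z \<in> carrier R" if "z \<in> ideal_prod R J K" for z
    using ideal_prod_in_carrier[OF J K] that by blast
  \<comment> \<open>Multiplication by j / r maps J K into J L. Applied to w = r it gives j itself,
    hence (j) is contained in J L.\<close>
  have "\<exists>z\<in>ideal_prod R J L. r \<otimes> z = j \<otimes> w" if "w \<in> ideal_prod R J K" for w
    using that
  proof induction
    case (prod a l)
    obtain c where c: "c \<in> carrier R" "j \<otimes> l = c \<otimes> r" using JK_mult[OF assms(2) prod(2)] by blast
    have ac: "a \<in> carrier R" "l \<in> carrier R" using prod J.Icarr K.Icarr by auto
    have rcc: "r \<otimes> c = j \<otimes> l" using c rc by (simp add: m_comm)
    then have "c \<in> L" using LI c(1) prod(2) by simp
    moreover have "r \<otimes> (a \<otimes> c) = a \<otimes> (r \<otimes> c)" using ac c(1) rc by (simp add: m_ac)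
    then have "r \<otimes> (a \<otimes> c) = j \<otimes> (a \<otimes> l)" unfolding rcc using ac jc by (simp add: m_ac)
    ultimately show ?case using ideal_prod.prod[OF prod(1), of c L R] by blast
  next
    case (sum v w)
    then obtain x y where x: "x \<in> ideal_prod R J L" "r \<otimes> x = j \<otimes> v"
      and y: "y \<in> ideal_prod R J L" "r \<otimes> y = j \<otimes> w" by blast
    have "r \<otimes> (x \<oplus> y) = j \<otimes> (v \<oplus> w)"
      using x y JLc JKc sum.hyps rc jc by (simp add: r_distr)
    then show ?case using ideal_prod.sum[OF x(1) y(1)] by blast
  qed
  moreover have "r \<in> ideal_prod R J K" unfolding JK using rc by (rule cgenideal_self)
  ultimately obtain z where z: "z \<in> ideal_prod R J L" "r \<otimes> z = j \<otimes> r" by blast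
  then have "z = j" using regular_cancel[OF r, of z j] JLc jc rc by (simp add: m_comm)
  then have "PIdl j \<subseteq> ideal_prod R J L"
    using cgenideal_minimal[OF ideal_prod_is_ideal[OF J L]] z(1) by simp
  moreover have "ideal_prod R J L \<subseteq> PIdl j"
  proof
    have P: "ideal (PIdl j) R" using jc by (rule cgenideal_ideal)
    fix x assume "x \<in> ideal_prod R J L"
    then show "x \<in> PIdl j"
    proof induction
      case (prod a k)
      obtain l where l: "k \<in> carrier R" "l \<in> K" "r \<otimes> k = j \<otimes> l"
        using prod(2) unfolding L_def by blast
      obtain c where c: "c \<in> carrier R" "a \<otimes> l = c \<otimes> r" using JK_mult[OF prod(1) l(2)] by blast
      have ac: "a \<in> carrier R" "l \<in> carrier R" using prod(1) l(2) J.Icarr K.Icarr by auto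
      have "r \<otimes> (a \<otimes> k) = a \<otimes> (r \<otimes> k)" using ac l(1) rc by (simp add: m_ac)
      also have "\<dots> = j \<otimes> (a \<otimes> l)" unfolding l(3) using ac jc by (simp add: m_ac)
      also have "\<dots> = r \<otimes> (c \<otimes> j)" unfolding c(2) using c(1) jc rc by (simp add: m_ac)
      finally have "a \<otimes> k = c \<otimes> j" using regular_cancel[OF r] ac l(1) c(1) jc by simp
      then show ?case using c(1) by (auto simp: cgenideal_def)
    next
      case (sum x y)
      then show ?case using additive_subgroup.a_closed[OF ideal.axioms(1)[OF P]] by blast
    qed
  qed
  ultimately show ?thesis using L by blast
qed

text \<open>Multiplying by the complement \<open>K\<close> turns the inclusion into (r) \<subseteq>
  H (r). Elements of H (r) have the form r y with a single y in \<open>H\<close>, so r = r y, and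
  regularity of r forces y = 1.\<close>

lemma (in cring) invertible_cancel:
  assumes "invertible_ideal R J" "ideal H R" "J \<subseteq> ideal_prod R J H"
  shows "H = carrier R"
proof -
  obtain K r where J: "ideal J R" and K: "ideal K R" and r: "r \<in> regular_elements R"
    and JK: "ideal_prod R J K = PIdl r"
    using assms(1) unfolding invertible_ideal_iff by blast
  have rc: "r \<in> carrier R" using r by (rule regular_elements_carrier)
  have P: "ideal (PIdl r) R" using rc by (rule cgenideal_ideal)
  have "PIdl r \<subseteq> ideal_prod R (ideal_prod R J H) K"
    unfolding JK[symmetric] using assms(3) by (intro ideal_prod_mono) auto
  also have "\<dots> = ideal_prod R H (PIdl r)"
    using ideal_prod_assoc ideal_prod_commute J K assms(2) JK P by metis
  finally have rmem: "r \<in> ideal_prod R H (PIdl r)" using cgenideal_self[OF rc] by blast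
  interpret H: ideal H R by fact
  have "\<exists>y\<in>H. x = r \<otimes> y" if "x \<in> ideal_prod R H (PIdl r)" for x
    using that
  proof induction
    case (prod a b)
    then obtain c where c: "c \<in> carrier R" "b = c \<otimes> r" by (auto simp: cgenideal_def)
    have "a \<otimes> b = r \<otimes> (c \<otimes> a)" using c rc H.Icarr[OF prod(1)] by (simp add: m_ac)
    then show ?case using H.I_l_closed[OF prod(1) c(1)] by blast
  next
    case (sum x y)
    then obtain a b where a: "a \<in> H" "x = r \<otimes> a" and b: "b \<in> H" "y = r \<otimes> b" by blast
    have "x \<oplus> y = r \<otimes> (a \<oplus> b)" using a b rc H.Icarr by (simp add: r_distr)
    then show ?case using H.a_closed[OF a(1) b(1)] by blast
  qed
  then obtain y where y: "y \<in> H" "r = r \<otimes> y" using rmem by blast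
  then have "r \<otimes> y = r \<otimes> \<one>" using rc by simp
  then have "y = \<one>" using regular_cancel[OF r, of y \<one>] y(1) H.Icarr by simp
  then show ?thesis using H.one_imp_carrier y(1) by simp
qed

section \<open>Factorizations\<close>

lemma (in ring) foldl_ideal_prod:
  assumes "ideal J R" "\<forall>H\<in>set Hs. ideal H R"
  shows "ideal (foldl (ideal_prod R) J Hs) R"
    and "foldl (ideal_prod R) J Hs \<subseteq> J"
    and "H \<in> set Hs \<Longrightarrow> foldl (ideal_prod R) J Hs \<subseteq> H"
proof -
  have "ideal (foldl (ideal_prod R) J Hs) R \<and> foldl (ideal_prod R) J Hs \<subseteq> J \<and>
      (\<forall>H\<in>set Hs. foldl (ideal_prod R) J Hs \<subseteq> H)"
    using assms
  proof (induction Hs arbitrary: J)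
    case (Cons H Hs)
    have JH: "ideal (ideal_prod R J H) R" "ideal_prod R J H \<subseteq> J \<inter> H"
      using ideal_prod_is_ideal ideal_prod_inter Cons.prems by auto
    then show ?case using Cons.IH[OF JH(1)] Cons.prems by auto
  qed simp
  then show "ideal (foldl (ideal_prod R) J Hs) R" "foldl (ideal_prod R) J Hs \<subseteq> J"
    "H \<in> set Hs \<Longrightarrow> foldl (ideal_prod R) J Hs \<subseteq> H" by auto
qed

text \<open>Unit ideals do not change a product. This removes the factors that cease to be proper
  after localization.\<close>

lemma (in ring) foldl_ideal_prod_carrier:
  assumes "ideal J R" "\<forall>H\<in>set Hs. ideal H R"
  shows "foldl (ideal_prod R) J (filter (\<lambda>H. H \<noteq> carrier R) Hs) = foldl (ideal_prod R) J Hs"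
  using assms by (induction Hs arbitrary: J) (auto simp: ideal_prod_one ideal_prod_is_ideal)

text \<open>The exponent may be zero here, although the radical requires n \<ge> 1: the power x^0 =
  1 lies in no proper ideal.\<close>

lemma (in cring) proper_radical_ideal_iff:
  "proper_radical_ideal R H \<longleftrightarrow> ideal H R \<and> H \<noteq> carrier R \<and>
    (\<forall>x\<in>carrier R. \<forall>n. x [^] (n::nat) \<in> H \<longrightarrow> x \<in> H)"
proof (cases "ideal H R \<and> H \<noteq> carrier R")
  case True
  then interpret H: ideal H R by simp
  have one: "\<one> \<notin> H" using True H.one_imp_carrier by blast
  have "ideal_radical R H = H \<longleftrightarrow> (\<forall>x\<in>carrier R. \<forall>n. x [^] (n::nat) \<in> H \<longrightarrow> x \<in> H)"
  proof
    assume e: "ideal_radical R H = H"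
    show "\<forall>x\<in>carrier R. \<forall>n. x [^] (n::nat) \<in> H \<longrightarrow> x \<in> H"
    proof (intro ballI allI impI)
      fix x n assume x: "x \<in> carrier R" "x [^] (n::nat) \<in> H"
      then have "n \<noteq> 0" using one by (intro notI) simp
      then have "x \<in> ideal_radical R H" using x by (auto simp: ideal_radical_def intro!: exI[of _ n])
      then show "x \<in> H" using e by simp
    qed
  next
    assume a: "\<forall>x\<in>carrier R. \<forall>n. x [^] (n::nat) \<in> H \<longrightarrow> x \<in> H"
    have "H \<subseteq> ideal_radical R H"
      using H.Icarr by (auto simp: ideal_radical_def intro!: exI[of _ "1::nat"])
    moreover have "ideal_radical R H \<subseteq> H" using a by (auto simp: ideal_radical_def)
    ultimately show "ideal_radical R H = H" by blast
  qed
  then show ?thesis using True unfolding proper_radical_ideal_def by simp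
qed (auto simp: proper_radical_ideal_def)

section \<open>Transfer of factorizations along surjective homomorphisms\<close>

locale surjective_ring_hom = ring_hom_cring R T h for R (structure) and T (structure) and h +
  assumes surj: "h ` carrier R = carrier T"
begin

lemma ideal_image:
  assumes "ideal I R"
  shows "ideal (h ` I) T"
proof -
  interpret I: ideal I R by fact
  show ?thesis
  proof (rule S.idealI_cring)
    show "h ` I \<subseteq> carrier T" using I.Icarr by auto
    show "\<zero>\<^bsub>T\<^esub> \<in> h ` I" using I.zero_closed by (intro image_eqI[of _ _ \<zero>]) auto
  next
    fix x y assume "x \<in> h ` I" "y \<in> h ` I"
    then obtain a b where "a \<in> I" "b \<in> I" "x = h a" "y = h b" by blast
    then show "x \<oplus>\<^bsub>T\<^esub> y \<in> h ` I"
      using I.Icarr I.a_closed by (intro image_eqI[of _ _ "a \<oplus> b"]) auto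
  next
    fix x c assume "x \<in> h ` I" "c \<in> carrier T"
    then obtain a b where "a \<in> I" "b \<in> carrier R" "x = h a" "c = h b" using surj by blast
    then show "c \<otimes>\<^bsub>T\<^esub> x \<in> h ` I"
      using I.Icarr I.I_l_closed by (intro image_eqI[of _ _ "b \<otimes> a"]) auto
  qed
qed

lemma image_ideal_prod:
  assumes "I \<subseteq> carrier R" "J \<subseteq> carrier R"
  shows "h ` ideal_prod R I J = ideal_prod T (h ` I) (h ` J)"
proof
  have "x \<in> carrier R \<and> h x \<in> ideal_prod T (h ` I) (h ` J)" if "x \<in> ideal_prod R I J" for x
    using that
  proof induction
    case (prod i j)
    then have "h i \<otimes>\<^bsub>T\<^esub> h j \<in> ideal_prod T (h ` I) (h ` J)" by (intro ideal_prod.prod) auto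
    then show ?case using prod assms by (simp add: subset_iff)
  next
    case (sum x y)
    then show ?case using ideal_prod.sum[of "h x" T "h ` I" "h ` J" "h y"] by simp
  qed
  then show "h ` ideal_prod R I J \<subseteq> ideal_prod T (h ` I) (h ` J)" by blast
  have "\<exists>a. a \<in> ideal_prod R I J \<and> a \<in> carrier R \<and> h a = x"
    if "x \<in> ideal_prod T (h ` I) (h ` J)" for x
    using that
  proof induction
    case (prod x y)
    then obtain i j where ij: "i \<in> I" "j \<in> J" "x = h i" "y = h j" by blast
    then have c: "i \<in> carrier R" "j \<in> carrier R" using assms by auto
    show ?case using ideal_prod.prod[OF ij(1,2), of R] ij(3,4) c by (intro exI[of _ "i \<otimes> j"]) simp
  next
    case (sum x y)
    then obtain a b where "a \<in> ideal_prod R I J" "a \<in> carrier R" "h a = x"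
      "b \<in> ideal_prod R I J" "b \<in> carrier R" "h b = y" by blast
    then show ?case using ideal_prod.sum[of a R I J b] by (intro exI[of _ "a \<oplus> b"]) auto
  qed
  then show "ideal_prod T (h ` I) (h ` J) \<subseteq> h ` ideal_prod R I J" by blast
qed

lemma image_foldl_ideal_prod:
  assumes "ideal J R" "\<forall>H\<in>set Hs. ideal H R"
  shows "h ` foldl (ideal_prod R) J Hs = foldl (ideal_prod T) (h ` J) (map ((`) h) Hs)"
  using assms
proof (induction Hs arbitrary: J)
  case (Cons H Hs)
  have "J \<subseteq> carrier R" "H \<subseteq> carrier R"
    using Cons.prems ideal.Icarr by (metis subsetI, metis list.set_intros(1) subsetI)
  then show ?case
    using Cons.IH[of "ideal_prod R J H"] Cons.prems R.ideal_prod_is_ideal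
    by (simp add: image_ideal_prod)
qed simp

lemma image_PIdl: "a \<in> carrier R \<Longrightarrow> h ` (PIdl a) = PIdl\<^bsub>T\<^esub> (h a)"
  unfolding cgenideal_def surj[symmetric] Setcompr_eq_image image_image by simp

lemma invertible_image:
  assumes "invertible_ideal R J" "j \<in> J" "h j \<in> regular_elements T"
  shows "invertible_ideal T (h ` J)"
proof -
  have J: "ideal J R" using assms(1) by (simp add: invertible_ideal_def)
  obtain K where K: "ideal K R" "ideal_prod R J K = PIdl j"
    using R.invertible_divides_principal[OF assms(1,2)] by blast
  have sub: "J \<subseteq> carrier R" "K \<subseteq> carrier R" "j \<in> carrier R"
    using ideal.Icarr[OF J] ideal.Icarr[OF K(1)] assms(2) by auto
  have "ideal_prod T (h ` J) (h ` K) = PIdl\<^bsub>T\<^esub> (h j)"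
    using image_ideal_prod[OF sub(1,2)] image_PIdl[OF sub(3)] K(2) by simp
  then show ?thesis
    unfolding S.invertible_ideal_iff using ideal_image J K(1) assms(3) by blast
qed

text \<open>If h x = h y with y in \<open>I\<close>, then x - y lies in the kernel, hence in
  \<open>I\<close>, and x = (x - y) + y.\<close>

lemma mem_image_ideal:
  assumes "ideal I R" "a_kernel R T h \<subseteq> I" "x \<in> carrier R" "h x \<in> h ` I"
  shows "x \<in> I"
proof -
  obtain y where y: "y \<in> I" "h x = h y" using assms(4) by blast
  interpret I: ideal I R by fact
  have yc: "y \<in> carrier R" using y(1) by (rule I.Icarr)
  have "h (x \<ominus> y) = \<zero>\<^bsub>T\<^esub>" using y(2) yc assms(3) by (simp add: R.minus_eq S.r_neg)
  then have "x \<ominus> y \<in> a_kernel R T h" unfolding a_kernel_def' using assms(3) yc by simp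
  then have "x \<ominus> y \<in> I" using assms(2) by blast
  then have "(x \<ominus> y) \<oplus> y \<in> I" using y(1) by simp
  then show ?thesis using assms(3) yc by (simp add: R.minus_eq R.a_assoc R.l_neg)
qed

lemma proper_radical_image:
  assumes "proper_radical_ideal R H" "a_kernel R T h \<subseteq> H"
  shows "proper_radical_ideal T (h ` H)"
proof -
  have H: "ideal H R" "H \<noteq> carrier R" "\<And>x n. x \<in> carrier R \<Longrightarrow> x [^] (n::nat) \<in> H \<Longrightarrow> x \<in> H"
    using assms(1) unfolding R.proper_radical_ideal_iff by blast+
  note mem = mem_image_ideal[OF H(1) assms(2)]
  have "h ` H \<noteq> carrier T"
    using H(2) mem surj ideal.Icarr[OF H(1)] by blast
  moreover have "y \<in> h ` H" if y: "y \<in> carrier T" "y [^]\<^bsub>T\<^esub> n \<in> h ` H" for y and n :: nat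
  proof -
    obtain x where x: "x \<in> carrier R" "y = h x" using y(1) surj by blast
    then have "h (x [^] n) \<in> h ` H" using y(2) by (simp add: hom_nat_pow)
    then have "x [^] n \<in> H" using mem x(1) by simp
    then show ?thesis using H(3) x by blast
  qed
  ultimately show ?thesis
    unfolding S.proper_radical_ideal_iff using ideal_image[OF H(1)] by blast
qed

text \<open>Only the source of a regular element in the image of \<open>J\<close> differs between
  the applications, so it is left as the premise \<open>reg\<close>. That premise supplies the
  contraction of \<open>I\<close> inside \<open>J\<close>, so the element may be taken from
  \<open>I\<close> itself.\<close>

lemma has_ISP_factorization_image:
  assumes "strongly_ISP_ring R" "ideal I T" "I \<noteq> carrier T"
    and reg: "\<And>J. invertible_ideal R J \<Longrightarrow> {a \<in> carrier R. h a \<in> I} \<subseteq> J \<Longrightarrow>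
      \<exists>j\<in>J. h j \<in> regular_elements T"
  shows "has_ISP_factorization T I"
proof -
  let ?I = "{a \<in> carrier R. h a \<in> I}"
  have "h ` ?I = carrier T \<inter> I" unfolding surj[symmetric] by auto
  then have hI: "h ` ?I = I" using ideal.Icarr[OF assms(2)] by auto
  have "ideal ?I R" 
    using ring_hom_ring.ideal_vimage[OF ring_hom_ringI2[OF R.ring_axioms S.ring_axioms homh] assms(2)]
    by simp
  moreover have "?I \<noteq> carrier R" using hI surj assms(3) by metis
  ultimately have "has_ISP_factorization R ?I"
    using assms(1) by (simp add: strongly_ISP_ring_def)
  then obtain J Hs where J: "invertible_ideal R J" "Hs \<noteq> []"
    "\<forall>H\<in>set Hs. proper_radical_ideal R H" "?I = foldl (ideal_prod R) J Hs"
    unfolding has_ISP_factorization_def by blast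
  have id: "ideal J R" "\<forall>H\<in>set Hs. ideal H R"
    using J(1,3) by (auto simp: invertible_ideal_def proper_radical_ideal_def)
  note sub = R.foldl_ideal_prod(2,3)[OF id, folded J(4)]
  have ker: "a_kernel R T h \<subseteq> ?I"
    unfolding a_kernel_def' using additive_subgroup.zero_closed[OF ideal.axioms(1)[OF assms(2)]]
    by (intro Collect_mono) simp
  have "proper_radical_ideal T (h ` H)" if H: "H \<in> set Hs" for H
    using proper_radical_image J(3) H order_trans[OF ker sub(2)[OF H]] by blast
  then have "\<forall>H\<in>set (map ((`) h) Hs). proper_radical_ideal T H" by simp
  moreover obtain j where "j \<in> J" "h j \<in> regular_elements T" using reg[OF J(1) sub(1)] by blast
  then have "invertible_ideal T (h ` J)" by (rule invertible_image[OF J(1)])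
  moreover have "I = foldl (ideal_prod T) (h ` J) (map ((`) h) Hs)"
    using image_foldl_ideal_prod[OF id] hI J(4) by simp
  ultimately show ?thesis
    unfolding has_ISP_factorization_def using J(2)
    by (intro exI[of _ "h ` J"] exI[of _ "map ((`) h) Hs"] conjI) simp_all
qed

text \<open>The case in which regular elements stay regular, as for coordinate projections and
  isomorphisms: any regular element of \<open>J\<close> then serves.\<close>

lemma strongly_ISP_ring_image:
  assumes "strongly_ISP_ring R" "\<one>\<^bsub>T\<^esub> \<noteq> \<zero>\<^bsub>T\<^esub>"
    and "\<And>r. r \<in> regular_elements R \<Longrightarrow> h r \<in> regular_elements T"
  shows "strongly_ISP_ring T"
proof -
  have "has_ISP_factorization T I" if "ideal I T" "I \<noteq> carrier T" for I
    using assms(1) that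
  proof (rule has_ISP_factorization_image)
    fix J assume "invertible_ideal R J"
    then show "\<exists>j\<in>J. h j \<in> regular_elements T"
      using R.invertible_regular_element assms(3) by blast
  qed
  then show ?thesis
    unfolding strongly_ISP_ring_def
    using nonzero_cring.intro[OF S.is_cring nonzero_cring_axioms.intro[OF assms(2)]] by blast
qed

end

lemma ISP_domain_quotient:
  assumes "strongly_ISP_ring A" "primeideal P A"
  shows "ISP_domain (A Quot P)"
proof -
  interpret P: primeideal P A by fact
  interpret Q: domain "A Quot P" by (rule P.quotient_is_domain)
  interpret surjective_ring_hom A "A Quot P" "(+>\<^bsub>A\<^esub>) P"
    by (intro surjective_ring_hom.intro P.rcos_ring_hom_cring surjective_ring_hom_axioms.intro)
      (auto simp: FactRing_def A_RCOSETS_def')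
  have reg: "x \<in> regular_elements (A Quot P)"
    if "x \<in> carrier (A Quot P)" "x \<noteq> \<zero>\<^bsub>A Quot P\<^esub>" for x
    using that Q.integral_iff by (intro regular_elementsI) auto
  have "has_ISP_factorization (A Quot P) I"
    if I: "ideal I (A Quot P)" "I \<noteq> carrier (A Quot P)" for I
  \<comment> \<open>The zero ideal is split off because a regular image is obtained from a nonzero
    element of \<open>I\<close>. It factors as the unit ideal times itself, being radical in a
    domain.\<close>
  proof (cases "I = {\<zero>\<^bsub>A Quot P\<^esub>}")
    case True
    have "proper_radical_ideal (A Quot P) I"
      unfolding Q.proper_radical_ideal_iff
    proof (intro conjI ballI allI impI I)
      fix x n assume "x \<in> carrier (A Quot P)" "x [^]\<^bsub>A Quot P\<^esub> (n::nat) \<in> I"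
      then have "x = \<zero>\<^bsub>A Quot P\<^esub>" unfolding True
        by (induction n) (auto simp: Q.integral_iff)
      then show "x \<in> I" unfolding True by simp
    qed
    moreover have "ideal_prod (A Quot P) (carrier (A Quot P)) I = I"
      using Q.ideal_prod_commute[OF Q.oneideal I(1)] Q.ideal_prod_one[OF I(1)] by simp
    ultimately show ?thesis
      unfolding has_ISP_factorization_def using Q.invertible_carrier
      by (intro exI[of _ "carrier (A Quot P)"] exI[of _ "[I]"]) simp
  next
    case False
    show ?thesis
      using assms(1) I
    proof (rule has_ISP_factorization_image)
      fix J assume J: "{a \<in> carrier A. P +>\<^bsub>A\<^esub> a \<in> I} \<subseteq> J"
      have "\<zero>\<^bsub>A Quot P\<^esub> \<in> I" using additive_subgroup.zero_closed[OF ideal.axioms(1)[OF I(1)]] .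
      then obtain x where x: "x \<in> I" "x \<noteq> \<zero>\<^bsub>A Quot P\<^esub>" using False by blast
      then have xc: "x \<in> carrier (A Quot P)" using ideal.Icarr[OF I(1)] by blast
      then obtain a where a: "a \<in> carrier A" "x = P +>\<^bsub>A\<^esub> a" using surj by blast
      then have "a \<in> J" using J x(1) by blast
      moreover have "P +>\<^bsub>A\<^esub> a \<in> regular_elements (A Quot P)" using reg[OF xc x(2)] a(2) by simp
      ultimately show "\<exists>j\<in>J. P +>\<^bsub>A\<^esub> j \<in> regular_elements (A Quot P)" by blast
    qed
  qed
  then show ?thesis unfolding ISP_domain_def using Q.domain_axioms by blast
qed

section \<open>Transfer of factorizations to rings of fractions\<close>

context localization_map
begin

lemma ext_foldl_ideal_prod:
  assumes "ideal J R" "\<forall>H\<in>set Hs. ideal H R"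
  shows "ext (foldl (ideal_prod R) J Hs) = foldl (ideal_prod T) (ext J) (map ext Hs)"
  using assms
proof (induction Hs arbitrary: J)
  case (Cons H Hs)
  then show ?case
    using Cons.IH[of "ideal_prod R J H"] R.ideal_prod_is_ideal by (simp add: ext_ideal_prod)
qed simp

text \<open>Extension commutes with products and principal ideals and keeps r regular, so J K = (r)
  extends directly.\<close>

lemma invertible_ext:
  assumes "invertible_ideal R J"
  shows "invertible_ideal T (ext J)"
proof -
  obtain K r where J: "ideal J R" and K: "ideal K R" and r: "r \<in> regular_elements R"
    and JK: "ideal_prod R J K = PIdl r"
    using assms unfolding R.invertible_ideal_iff by blast
  have "ideal_prod T (ext J) (ext K) = PIdl\<^bsub>T\<^esub> (h r)"
    using ext_ideal_prod[OF J K] ext_PIdl[OF regular_elements_carrier[OF r]] JK by simp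
  then show ?thesis
    unfolding S.invertible_ideal_iff using ideal_ext J K regular_hom[OF r] by blast
qed

text \<open>An extended ideal contracts to the \<open>U\<close>-saturation of the ideal. The
  multiplier \<open>w\<close> combines the denominator of the fraction with the factor that turns an
  equality of images into one in \<open>R\<close>.\<close>

lemma hom_mem_extD:
  assumes "ideal I R" "a \<in> carrier R" "h a \<in> ext I"
  shows "\<exists>w\<in>U. w \<otimes> a \<in> I"
proof -
  obtain u b where u: "u \<in> U" "b \<in> I" "h u \<otimes>\<^bsub>T\<^esub> h a = h b" using assms(3) by (rule extE)
  have bc: "b \<in> carrier R" using ideal.Icarr[OF assms(1) u(2)] .
  have "h (u \<otimes> a) = h b" using u assms(2) by simp
  then obtain v where v: "v \<in> U" "v \<otimes> (u \<otimes> a) = v \<otimes> b"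
    using hom_eqD[of "u \<otimes> a" b] u(1) assms(2) bc by auto
  have "(v \<otimes> u) \<otimes> a = v \<otimes> b" using v u(1) assms(2) by (simp add: R.m_assoc)
  moreover have "v \<otimes> b \<in> I" using ideal.I_l_closed[OF assms(1) u(2)] v(1) by simp
  ultimately show ?thesis using U.m_closed[OF v(1) u(1)] by metis
qed

text \<open>If (a/u)^n lies in the extension, then w a^n lies in \<open>H\<close> for some w in
  \<open>U\<close>. So a power of w a lies in \<open>H\<close>, hence w a does, and a/u = (w a)/(w
  u).\<close>

lemma proper_radical_ext:
  assumes "proper_radical_ideal R H" "ext H \<noteq> carrier T"
  shows "proper_radical_ideal T (ext H)"
proof -
  have H: "ideal H R" "\<And>x n. x \<in> carrier R \<Longrightarrow> x [^] (n::nat) \<in> H \<Longrightarrow> x \<in> H"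
    using assms(1) unfolding R.proper_radical_ideal_iff by blast+
  have "x \<in> ext H" if x: "x \<in> carrier T" "x [^]\<^bsub>T\<^esub> n \<in> ext H" for x and n :: nat
  proof -
    obtain a u where a: "a \<in> carrier R" "u \<in> U" "h u \<otimes>\<^bsub>T\<^esub> x = h a" using fraction[OF x(1)] by blast
    have "h (a [^] n) = (h u \<otimes>\<^bsub>T\<^esub> x) [^]\<^bsub>T\<^esub> n" using a(1) by (simp add: a(3) hom_nat_pow)
    also have "\<dots> = (h u) [^]\<^bsub>T\<^esub> n \<otimes>\<^bsub>T\<^esub> x [^]\<^bsub>T\<^esub> n"
      using a(2) x(1) by (simp add: S.nat_pow_distrib)
    also have "\<dots> \<in> ext H" using ideal.I_l_closed[OF ideal_ext[OF H(1)] x(2)] a(2) by simp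
    finally obtain w where w: "w \<in> U" "w \<otimes> a [^] n \<in> H"
      using hom_mem_extD[OF H(1), of "a [^] n"] a(1) by auto
    \<comment> \<open>The exponent \<open>Suc n\<close> instead of \<open>n\<close> provides the one
      factor \<open>w\<close> needed next to a^n even when n = 0.\<close>
    have "(w \<otimes> a) [^] Suc n = (w [^] n \<otimes> a) \<otimes> (w \<otimes> a [^] n)"
      using w(1) a(1) by (simp add: R.nat_pow_distrib R.m_ac)
    also have "\<dots> \<in> H" using ideal.I_l_closed[OF H(1) w(2)] w(1) a(1) by simp
    finally have wa: "w \<otimes> a \<in> H" using H(2)[of "w \<otimes> a" "Suc n"] w(1) a(1) by simp
    have "h (w \<otimes> u) \<otimes>\<^bsub>T\<^esub> x = h w \<otimes>\<^bsub>T\<^esub> (h u \<otimes>\<^bsub>T\<^esub> x)"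
      using w(1) a(2) x(1) by (simp add: S.m_assoc)
    then have "h (w \<otimes> u) \<otimes>\<^bsub>T\<^esub> x = h (w \<otimes> a)" using w(1) a(1,3) by simp
    then show ?thesis using extI[OF x(1) _ wa, of "w \<otimes> u"] w(1) a(2) by simp
  qed
  then show ?thesis
    unfolding S.proper_radical_ideal_iff using assms(2) ideal_ext[OF H(1)] by blast
qed

text \<open>
  Some factor \<open>H\<close> of the contraction of \<open>I\<close> has to extend to a proper ideal: otherwise \<open>I\<close> is the
  extension of \<open>J\<close>, so that \<open>J\<close> is contained in the contraction \<open>J H\<^sub>1 \<dots> H\<^sub>n\<close>, which cancellation
  of \<open>J\<close> excludes.
\<close>

lemma strongly_ISP_ring_localization:
  assumes "strongly_ISP_ring R" "\<one>\<^bsub>T\<^esub> \<noteq> \<zero>\<^bsub>T\<^esub>"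
  shows "strongly_ISP_ring T"
proof -
  have "has_ISP_factorization T I" if I: "ideal I T" "I \<noteq> carrier T" for I
  proof -
    let ?C = "{a \<in> carrier R. h a \<in> I}"
    have "ideal ?C R"
      using ring_hom_ring.ideal_vimage[OF ring_hom_ringI2[OF R.ring_axioms S.ring_axioms homh] I(1)]
      by simp
    moreover have "?C \<noteq> carrier R"
    proof
      assume "?C = carrier R"
      then have "\<one> \<in> ?C" using R.one_closed by simp
      then show False using ideal.one_imp_carrier[OF I(1)] I(2) by simp
    qed
    ultimately have "has_ISP_factorization R ?C"
      using assms(1) by (simp add: strongly_ISP_ring_def)
    then obtain J Hs where J: "invertible_ideal R J" "Hs \<noteq> []"
      "\<forall>H\<in>set Hs. proper_radical_ideal R H" "?C = foldl (ideal_prod R) J Hs"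
      unfolding has_ISP_factorization_def by blast
    have id: "ideal J R" "\<forall>H\<in>set Hs. ideal H R"
      using J(1,3) by (auto simp: invertible_ideal_def proper_radical_ideal_def)
    let ?Hs = "filter (\<lambda>H. H \<noteq> carrier T) (map ext Hs)"
    have "I = ext ?C" using ext_contraction[OF I(1)] by simp
    also have "\<dots> = foldl (ideal_prod T) (ext J) (map ext Hs)"
      unfolding J(4) by (rule ext_foldl_ideal_prod[OF id])
    also have "\<dots> = foldl (ideal_prod T) (ext J) ?Hs"
      by (rule S.foldl_ideal_prod_carrier[symmetric]) (use id ideal_ext in auto)
    finally have I_eq: "I = foldl (ideal_prod T) (ext J) ?Hs" .
    moreover have "?Hs \<noteq> []"
    proof
      assume "?Hs = []"
      then have "I = ext J" using I_eq by simp
      moreover have Jc: "J \<subseteq> carrier R" using ideal.Icarr[OF id(1)] by blast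
      ultimately have "J \<subseteq> ?C" using hom_in_ext[OF Jc] by blast
      \<comment> \<open>A single factor suffices: the contraction lies in J H, and \<open>H\<close>
        is proper in \<open>R\<close> although its extension is not.\<close>
      obtain H Hs' where Hs: "Hs = H # Hs'" using J(2) by (cases Hs) auto
      have H: "ideal H R" "H \<noteq> carrier R" using J(3) Hs by (auto simp: proper_radical_ideal_def)
      have "?C = foldl (ideal_prod R) (ideal_prod R J H) Hs'" using J(4) Hs by simp
      also have "\<dots> \<subseteq> ideal_prod R J H"
        by (rule R.foldl_ideal_prod(2)) (use R.ideal_prod_is_ideal id Hs in auto)
      finally have "J \<subseteq> ideal_prod R J H" using \<open>J \<subseteq> ?C\<close> by (rule order_trans[rotated])
      then show False using R.invertible_cancel[OF J(1) H(1)] H(2) by blast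
    qed
    moreover have "\<forall>H\<in>set ?Hs. proper_radical_ideal T H"
      using J(3) proper_radical_ext by auto
    ultimately show ?thesis
      unfolding has_ISP_factorization_def using invertible_ext[OF J(1)] by blast
  qed
  then show ?thesis
    unfolding strongly_ISP_ring_def
    using nonzero_cring.intro[OF S.is_cring nonzero_cring_axioms.intro[OF assms(2)]] by blast
qed

end

lemma strongly_ISP_ring_localization_submonoid:
  assumes "strongly_ISP_ring A" "submonoid S A" "\<zero>\<^bsub>A\<^esub> \<notin> S"
  shows "strongly_ISP_ring (localization A S)"
proof -
  interpret cring A
    using assms(1) by (simp add: strongly_ISP_ring_def nonzero_cring_def)
  interpret fractions A S by (intro fractions.intro is_cring assms(2))
  interpret localization_map A "localization A S" "\<lambda>a. fraction A S a \<one>\<^bsub>A\<^esub>" S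
    by (rule localization_map_localization)
  \<comment> \<open>If 1/1 = 0/1, then u 1 = 0 for some u in \<open>S\<close>, so \<open>S\<close>
    would contain zero.\<close>
  have "\<one>\<^bsub>localization A S\<^esub> \<noteq> \<zero>\<^bsub>localization A S\<^esub>"
  proof
    assume "\<one>\<^bsub>localization A S\<^esub> = \<zero>\<^bsub>localization A S\<^esub>"
    then have "\<exists>u\<in>S. u \<otimes>\<^bsub>A\<^esub> \<one>\<^bsub>A\<^esub> = \<zero>\<^bsub>A\<^esub>" using kernel[of "\<one>\<^bsub>A\<^esub>"] hom_one by simp
    then show False using assms(3) by auto
  qed
  then show ?thesis by (rule strongly_ISP_ring_localization[OF assms(1)])
qed

section \<open>Direct products\<close>

lemma RDirProd_simps [simp]:
  "carrier (RDirProd R S) = carrier R \<times> carrier S"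
  "(a, b) \<otimes>\<^bsub>RDirProd R S\<^esub> (c, d) = (a \<otimes>\<^bsub>R\<^esub> c, b \<otimes>\<^bsub>S\<^esub> d)"
  "(a, b) \<oplus>\<^bsub>RDirProd R S\<^esub> (c, d) = (a \<oplus>\<^bsub>R\<^esub> c, b \<oplus>\<^bsub>S\<^esub> d)"
  "\<one>\<^bsub>RDirProd R S\<^esub> = (\<one>\<^bsub>R\<^esub>, \<one>\<^bsub>S\<^esub>)"
  "\<zero>\<^bsub>RDirProd R S\<^esub> = (\<zero>\<^bsub>R\<^esub>, \<zero>\<^bsub>S\<^esub>)"
  by (simp_all add: RDirProd_def DirProd_def monoid.defs)

lemma RDirProd_nat_pow:
  "(a, b) [^]\<^bsub>RDirProd R S\<^esub> (n::nat) = (a [^]\<^bsub>R\<^esub> n, b [^]\<^bsub>S\<^esub> n)"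
  by (induction n) (simp_all add: nat_pow_def)

locale cring_pair = R: cring R + S: cring S for R (structure) and S (structure)
begin

abbreviation P where "P \<equiv> RDirProd R S"

lemma cring_P: "cring P"
proof -
  interpret P: ring P by (intro RDirProd_ring R.ring_axioms S.ring_axioms)
  show ?thesis
    by (intro cring.intro P.ring_axioms P.monoid_comm_monoidI) (auto simp: R.m_comm S.m_comm)
qed

sublocale P: cring P
  by (rule cring_P)

text \<open>Regarding the projections as surjections makes the passage from the product to its
  factors an instance of the transfer above.\<close>

sublocale fst: surjective_ring_hom P R fst
proof (intro surjective_ring_hom.intro ring_hom_cring.intro ring_hom_cring_axioms.intro
    surjective_ring_hom_axioms.intro cring_P R.is_cring)
  show "fst \<in> ring_hom P R" by (rule ring_hom_memI) auto
  show "fst ` carrier P = carrier R" using S.zero_closed by force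
qed

sublocale snd: surjective_ring_hom P S snd
proof (intro surjective_ring_hom.intro ring_hom_cring.intro ring_hom_cring_axioms.intro
    surjective_ring_hom_axioms.intro cring_P S.is_cring)
  show "snd \<in> ring_hom P S" by (rule ring_hom_memI) auto
  show "snd ` carrier P = carrier S" using R.zero_closed by force
qed

text \<open>To recover regularity in one coordinate, test against pairs whose other coordinate is
  zero.\<close>

lemma regular_P_iff:
  "(r, s) \<in> regular_elements P \<longleftrightarrow> r \<in> regular_elements R \<and> s \<in> regular_elements S"
proof (intro iffI conjI)
  assume rs: "(r, s) \<in> regular_elements P"
  then have c: "r \<in> carrier R" "s \<in> carrier S" using regular_elements_carrier[OF rs] by auto
  show "r \<in> regular_elements R"
  proof (rule regular_elementsI[OF c(1)])
    fix x assume "x \<in> carrier R" "r \<otimes>\<^bsub>R\<^esub> x = \<zero>\<^bsub>R\<^esub>"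
    then show "x = \<zero>\<^bsub>R\<^esub>" using regular_elementsD[OF rs, of "(x, \<zero>\<^bsub>S\<^esub>)"] c by simp
  qed
  show "s \<in> regular_elements S"
  proof (rule regular_elementsI[OF c(2)])
    fix x assume "x \<in> carrier S" "s \<otimes>\<^bsub>S\<^esub> x = \<zero>\<^bsub>S\<^esub>"
    then show "x = \<zero>\<^bsub>S\<^esub>" using regular_elementsD[OF rs, of "(\<zero>\<^bsub>R\<^esub>, x)"] c by simp
  qed
next
  assume "r \<in> regular_elements R \<and> s \<in> regular_elements S"
  then have rs: "r \<in> regular_elements R" "s \<in> regular_elements S" by auto
  show "(r, s) \<in> regular_elements P"
  proof (rule regular_elementsI)
    show "(r, s) \<in> carrier P" using rs[THEN regular_elements_carrier] by simp
    fix x assume x: "x \<in> carrier P" "(r, s) \<otimes>\<^bsub>P\<^esub> x = \<zero>\<^bsub>P\<^esub>"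
    obtain a b where ab: "x = (a, b)" by (cases x)
    show "x = \<zero>\<^bsub>P\<^esub>"
      using regular_elementsD[OF rs(1), of a] regular_elementsD[OF rs(2), of b] x ab by simp
  qed
qed

lemma ideal_Times:
  assumes "ideal I R" "ideal K S"
  shows "ideal (I \<times> K) P"
proof -
  interpret I: ideal I R by fact
  interpret K: ideal K S by fact
  show ?thesis
    by (rule P.idealI_cring)
      (auto simp: I.Icarr K.Icarr I.a_closed K.a_closed I.I_l_closed K.I_l_closed)
qed

text \<open>Multiplication by the idempotents (1, 0) and (0, 1) isolates the coordinates, so (a, d)
  is recovered from (a, b) and (c, d).\<close>

lemma ideal_P_eq_Times:
  assumes "ideal I P"
  shows "I = fst ` I \<times> snd ` I"
proof
  interpret I: ideal I P by fact
  show "fst ` I \<times> snd ` I \<subseteq> I"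
  proof clarify
    fix a b c d assume ab: "(a, b) \<in> I" and cd: "(c, d) \<in> I"
    have c: "a \<in> carrier R" "b \<in> carrier S" "c \<in> carrier R" "d \<in> carrier S"
      using I.Icarr[OF ab] I.Icarr[OF cd] by auto
    have "(\<one>\<^bsub>R\<^esub>, \<zero>\<^bsub>S\<^esub>) \<otimes>\<^bsub>P\<^esub> (a, b) \<oplus>\<^bsub>P\<^esub> (\<zero>\<^bsub>R\<^esub>, \<one>\<^bsub>S\<^esub>) \<otimes>\<^bsub>P\<^esub> (c, d) \<in> I"
      by (intro I.a_closed I.I_l_closed ab cd) auto
    then show "(fst (a, b), snd (c, d)) \<in> I" using c by simp
  qed
qed force

lemma ideal_prod_Times:
  assumes "ideal I R" "ideal I' R" "ideal K S" "ideal K' S"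
  shows "ideal_prod P (I \<times> K) (I' \<times> K') = ideal_prod R I I' \<times> ideal_prod S K K'"
proof
  have zero: "\<zero>\<^bsub>R\<^esub> \<in> I" "\<zero>\<^bsub>R\<^esub> \<in> I'" "\<zero>\<^bsub>S\<^esub> \<in> K" "\<zero>\<^bsub>S\<^esub> \<in> K'"
    using assms by (auto intro: additive_subgroup.zero_closed ideal.axioms(1))
  have "fst x \<in> ideal_prod R I I' \<and> snd x \<in> ideal_prod S K K'"
    if "x \<in> ideal_prod P (I \<times> K) (I' \<times> K')" for x
    using that
  proof induction
    case (prod x y)
    obtain a b where x: "x = (a, b)" by (cases x)
    obtain c d where y: "y = (c, d)" by (cases y)
    have "a \<in> I" "c \<in> I'" "b \<in> K" "d \<in> K'" using prod x y by auto
    then show ?case unfolding x y by (simp add: ideal_prod.prod)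
  next
    case (sum x y)
    obtain a b where x: "x = (a, b)" by (cases x)
    obtain c d where y: "y = (c, d)" by (cases y)
    have "a \<in> ideal_prod R I I'" "c \<in> ideal_prod R I I'"
      "b \<in> ideal_prod S K K'" "d \<in> ideal_prod S K K'"
      using sum.IH x y by auto
    then show ?case unfolding x y by (simp add: ideal_prod.sum)
  qed
  then show "ideal_prod P (I \<times> K) (I' \<times> K') \<subseteq> ideal_prod R I I' \<times> ideal_prod S K K'"
    by (auto simp: mem_Times_iff)
  \<comment> \<open>The two coordinates may be sums with different numbers of terms. Each is
    therefore embedded alone, with zero in the other place, and the results are added.\<close>
  have left: "(x, \<zero>\<^bsub>S\<^esub>) \<in> ideal_prod P (I \<times> K) (I' \<times> K')" if "x \<in> ideal_prod R I I'" for x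
    using that
  proof induction
    case (prod a b)
    then show ?case using zero ideal_prod.prod[of "(a, \<zero>\<^bsub>S\<^esub>)" "I \<times> K" "(b, \<zero>\<^bsub>S\<^esub>)" "I' \<times> K'" P] by simp
  next
    case (sum a b)
    then show ?case using ideal_prod.sum[OF sum.IH] by simp
  qed
  have right: "(\<zero>\<^bsub>R\<^esub>, x) \<in> ideal_prod P (I \<times> K) (I' \<times> K')" if "x \<in> ideal_prod S K K'" for x
    using that
  proof induction
    case (prod a b)
    then show ?case using zero ideal_prod.prod[of "(\<zero>\<^bsub>R\<^esub>, a)" "I \<times> K" "(\<zero>\<^bsub>R\<^esub>, b)" "I' \<times> K'" P] by simp
  next
    case (sum a b)
    then show ?case using ideal_prod.sum[OF sum.IH] by simp
  qed
  show "ideal_prod R I I' \<times> ideal_prod S K K' \<subseteq> ideal_prod P (I \<times> K) (I' \<times> K')"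
  proof clarify
    fix x y assume xy: "x \<in> ideal_prod R I I'" "y \<in> ideal_prod S K K'"
    then have "x \<in> carrier R" "y \<in> carrier S"
      using R.ideal_prod_in_carrier[OF assms(1,2)] S.ideal_prod_in_carrier[OF assms(3,4)] by auto
    then show "(x, y) \<in> ideal_prod P (I \<times> K) (I' \<times> K')"
      using ideal_prod.sum[OF left[OF xy(1)] right[OF xy(2)]] by simp
  qed
qed

lemma PIdl_P: "PIdl\<^bsub>P\<^esub> (r, s) = (PIdl\<^bsub>R\<^esub> r) \<times> (PIdl\<^bsub>S\<^esub> s)"
  by (auto simp: cgenideal_def)

lemma invertible_Times:
  assumes "invertible_ideal R J" "invertible_ideal S J'"
  shows "invertible_ideal P (J \<times> J')"
proof -
  obtain K r where J: "ideal J R" "ideal K R" "r \<in> regular_elements R" "ideal_prod R J K = PIdl\<^bsub>R\<^esub> r"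
    using assms(1) unfolding R.invertible_ideal_iff by blast
  obtain K' s where J': "ideal J' S" "ideal K' S" "s \<in> regular_elements S"
    "ideal_prod S J' K' = PIdl\<^bsub>S\<^esub> s"
    using assms(2) unfolding S.invertible_ideal_iff by blast
  have "ideal_prod P (J \<times> J') (K \<times> K') = PIdl\<^bsub>P\<^esub> (r, s)"
    using ideal_prod_Times[OF J(1,2) J'(1,2)] J(4) J'(4) PIdl_P by simp
  moreover have "(r, s) \<in> regular_elements P" using regular_P_iff J(3) J'(3) by blast
  ultimately show ?thesis
    unfolding P.invertible_ideal_iff using ideal_Times J(1,2) J'(1,2) by blast
qed

text \<open>Padding by the whole ring keeps the ideal proper and radical, so each radical factor can
  be used in one coordinate only.\<close>

lemma proper_radical_Times_carrier:
  assumes "proper_radical_ideal R H"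
  shows "proper_radical_ideal P (H \<times> carrier S)"
proof -
  have H: "ideal H R" "H \<noteq> carrier R"
    and rad: "\<And>x n. x \<in> carrier R \<Longrightarrow> x [^]\<^bsub>R\<^esub> (n::nat) \<in> H \<Longrightarrow> x \<in> H"
    using assms unfolding R.proper_radical_ideal_iff by blast+
  show ?thesis
    unfolding P.proper_radical_ideal_iff
  proof (intro conjI ballI allI impI)
    show "ideal (H \<times> carrier S) P" using H(1) by (intro ideal_Times R.oneideal S.oneideal)
    show "H \<times> carrier S \<noteq> carrier P" using H(2) R.zero_closed S.zero_closed by (auto simp: times_eq_iff)
    fix x n assume x: "x \<in> carrier P" "x [^]\<^bsub>P\<^esub> (n::nat) \<in> H \<times> carrier S"
    obtain a b where ab: "x = (a, b)" by (cases x)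
    show "x \<in> H \<times> carrier S" using x rad[of a n] unfolding ab by (simp add: RDirProd_nat_pow)
  qed
qed

lemma proper_radical_carrier_Times:
  assumes "proper_radical_ideal S H"
  shows "proper_radical_ideal P (carrier R \<times> H)"
proof -
  have H: "ideal H S" "H \<noteq> carrier S"
    and rad: "\<And>x n. x \<in> carrier S \<Longrightarrow> x [^]\<^bsub>S\<^esub> (n::nat) \<in> H \<Longrightarrow> x \<in> H"
    using assms unfolding S.proper_radical_ideal_iff by blast+
  show ?thesis
    unfolding P.proper_radical_ideal_iff
  proof (intro conjI ballI allI impI)
    show "ideal (carrier R \<times> H) P" using H(1) by (intro ideal_Times R.oneideal S.oneideal)
    show "carrier R \<times> H \<noteq> carrier P" using H(2) R.zero_closed S.zero_closed by (auto simp: times_eq_iff)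
    fix x n assume x: "x \<in> carrier P" "x [^]\<^bsub>P\<^esub> (n::nat) \<in> carrier R \<times> H"
    obtain a b where ab: "x = (a, b)" by (cases x)
    show "x \<in> carrier R \<times> H" using x rad[of b n] unfolding ab by (simp add: RDirProd_nat_pow)
  qed
qed

text \<open>The padded factors multiply the second coordinate by the unit ideal and leave it
  unchanged.\<close>

lemma foldl_Times_carrier:
  assumes "ideal I R" "ideal K S" "\<forall>H\<in>set Hs. ideal H R"
  shows "foldl (ideal_prod P) (I \<times> K) (map (\<lambda>H. H \<times> carrier S) Hs) = foldl (ideal_prod R) I Hs \<times> K"
  using assms
  by (induction Hs arbitrary: I)
    (auto simp: ideal_prod_Times S.oneideal S.ideal_prod_one R.ideal_prod_is_ideal)

lemma foldl_carrier_Times: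
  assumes "ideal I R" "ideal K S" "\<forall>H\<in>set Hs. ideal H S"
  shows "foldl (ideal_prod P) (I \<times> K) (map (\<lambda>H. carrier R \<times> H) Hs) = I \<times> foldl (ideal_prod S) K Hs"
  using assms
  by (induction Hs arbitrary: K)
    (auto simp: ideal_prod_Times R.oneideal R.ideal_prod_one S.ideal_prod_is_ideal)

end

text \<open>A proper ideal of a product may have the whole ring as one coordinate. That coordinate
  is covered by admitting the empty list for the unit ideal.\<close>

lemma strongly_ISP_ring_ideal_factorization:
  assumes "strongly_ISP_ring R" "ideal I R"
  obtains J Hs where "invertible_ideal R J" "\<forall>H\<in>set Hs. proper_radical_ideal R H"
    "I = foldl (ideal_prod R) J Hs" "I \<noteq> carrier R \<Longrightarrow> Hs \<noteq> []"
proof (cases "I = carrier R")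
  case True
  interpret cring R
    using assms(1) by (simp add: strongly_ISP_ring_def nonzero_cring_def)
  show ?thesis using True invertible_carrier by (intro that[of "carrier R" "[]"]) simp_all
next
  case False
  then have "has_ISP_factorization R I" using assms by (simp add: strongly_ISP_ring_def)
  then show ?thesis unfolding has_ISP_factorization_def using that by blast
qed

lemma (in cring_pair) strongly_ISP_ring_P_iff:
  assumes "\<one>\<^bsub>R\<^esub> \<noteq> \<zero>\<^bsub>R\<^esub>" "\<one>\<^bsub>S\<^esub> \<noteq> \<zero>\<^bsub>S\<^esub>"
  shows "strongly_ISP_ring P \<longleftrightarrow> strongly_ISP_ring R \<and> strongly_ISP_ring S"
proof (intro iffI conjI)
  assume ISP: "strongly_ISP_ring P"
  show "strongly_ISP_ring R"
    using fst.strongly_ISP_ring_image[OF ISP assms(1)] regular_P_iff by (metis prod.collapse)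
  show "strongly_ISP_ring S"
    using snd.strongly_ISP_ring_image[OF ISP assms(2)] regular_P_iff by (metis prod.collapse)
next
  assume ISP: "strongly_ISP_ring R \<and> strongly_ISP_ring S"
  have "has_ISP_factorization P I" if I: "ideal I P" "I \<noteq> carrier P" for I
  proof -
    let ?I = "fst ` I" and ?K = "snd ` I"
    have eq: "I = ?I \<times> ?K" by (rule ideal_P_eq_Times[OF I(1)])
    obtain J Hs where J: "invertible_ideal R J" "\<forall>H\<in>set Hs. proper_radical_ideal R H"
      "?I = foldl (ideal_prod R) J Hs" "?I \<noteq> carrier R \<Longrightarrow> Hs \<noteq> []"
      using strongly_ISP_ring_ideal_factorization ISP fst.ideal_image[OF I(1)] by blast
    obtain J' Hs' where J': "invertible_ideal S J'" "\<forall>H\<in>set Hs'. proper_radical_ideal S H"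
      "?K = foldl (ideal_prod S) J' Hs'" "?K \<noteq> carrier S \<Longrightarrow> Hs' \<noteq> []"
      using strongly_ISP_ring_ideal_factorization ISP snd.ideal_image[OF I(1)] by blast
    have id: "ideal J R" "\<forall>H\<in>set Hs. ideal H R" "ideal J' S" "\<forall>H\<in>set Hs'. ideal H S"
      using J(1,2) J'(1,2) by (auto simp: invertible_ideal_def proper_radical_ideal_def)
    \<comment> \<open>The first block of factors produces the first coordinate and the second block
      the other, so the lengths need not agree. Since \<open>I\<close> is proper, at least one block
      is nonempty.\<close>
    let ?Hs = "map (\<lambda>H. H \<times> carrier S) Hs @ map (\<lambda>H. carrier R \<times> H) Hs'"
    have "foldl (ideal_prod P) (J \<times> J') ?Hs = ?I \<times> ?K"
      using foldl_Times_carrier[OF id(1,3,2)] J(3) J'(3)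
        foldl_carrier_Times[OF fst.ideal_image[OF I(1)] id(3,4)] by simp
    then have "I = foldl (ideal_prod P) (J \<times> J') ?Hs" using eq by simp
    moreover have "?Hs \<noteq> []"
    proof
      assume "?Hs = []"
      then have "?I = carrier R" "?K = carrier S" using J(4) J'(4) by auto
      then show False using eq I(2) by simp
    qed
    moreover have "\<forall>H\<in>set ?Hs. proper_radical_ideal P H"
      using J(2) J'(2) proper_radical_Times_carrier proper_radical_carrier_Times by auto
    ultimately show ?thesis
      unfolding has_ISP_factorization_def using invertible_Times[OF J(1) J'(1)] by blast
  qed
  moreover have "nonzero_cring P"
    using assms(1) by (intro nonzero_cring.intro cring_P nonzero_cring_axioms.intro) simp
  ultimately show "strongly_ISP_ring P" unfolding strongly_ISP_ring_def by blast
qed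

section \<open>Isomorphisms and products of lists of rings\<close>

lemma ring_iso_cring:
  assumes "cring R" "ring S" "f \<in> ring_iso R S"
  shows "cring S"
proof -
  interpret R: cring R by fact
  interpret S: ring S by fact
  have hom: "f \<in> ring_hom R S" and surj: "f ` carrier R = carrier S"
    using assms(3) by (auto simp: ring_iso_def bij_betw_def)
  have "x \<otimes>\<^bsub>S\<^esub> y = y \<otimes>\<^bsub>S\<^esub> x" if xy: "x \<in> carrier S" "y \<in> carrier S" for x y
  proof -
    obtain a b where a: "a \<in> carrier R" "b \<in> carrier R" "x = f a" "y = f b" using xy surj by blast
    then show ?thesis using ring_hom_mult[OF hom] R.m_comm by metis
  qed
  then show ?thesis by (intro cring.intro S.ring_axioms S.monoid_comm_monoidI)
qed

text \<open>An isomorphism is a surjection that preserves regularity: by injectivity, f r f x = 0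
  forces r x = 0.\<close>

lemma ring_iso_strongly_ISP_ring:
  assumes "cring R" "cring S" "f \<in> ring_iso R S" "strongly_ISP_ring R"
  shows "strongly_ISP_ring S"
proof -
  have hom: "f \<in> ring_hom R S" and surj: "f ` carrier R = carrier S" and inj: "inj_on f (carrier R)"
    using assms(3) by (auto simp: ring_iso_def bij_betw_def)
  interpret R: cring R by fact
  interpret S: cring S by fact
  interpret surjective_ring_hom R S f
    by (intro surjective_ring_hom.intro ring_hom_cring.intro ring_hom_cring_axioms.intro
        surjective_ring_hom_axioms.intro assms hom surj)
  have inj_zero: "x = \<zero>\<^bsub>R\<^esub>" if "x \<in> carrier R" "f x = \<zero>\<^bsub>S\<^esub>" for x
    using inj_onD[OF inj, of x "\<zero>\<^bsub>R\<^esub>"] that by simp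
  show ?thesis
  proof (rule strongly_ISP_ring_image[OF assms(4)])
    have "\<one>\<^bsub>R\<^esub> \<noteq> \<zero>\<^bsub>R\<^esub>"
      using assms(4) by (simp add: strongly_ISP_ring_def nonzero_cring_def nonzero_cring_axioms_def)
    then show "\<one>\<^bsub>S\<^esub> \<noteq> \<zero>\<^bsub>S\<^esub>" using inj_zero[OF R.one_closed] hom_one by metis
  next
    fix r assume r: "r \<in> regular_elements R"
    note rc = regular_elements_carrier[OF r]
    show "f r \<in> regular_elements S"
    proof (rule regular_elementsI)
      fix y assume y: "y \<in> carrier S" "f r \<otimes>\<^bsub>S\<^esub> y = \<zero>\<^bsub>S\<^esub>"
      then obtain x where x: "x \<in> carrier R" "y = f x" using surj by blast
      then have "r \<otimes>\<^bsub>R\<^esub> x = \<zero>\<^bsub>R\<^esub>" using inj_zero[of "r \<otimes>\<^bsub>R\<^esub> x"] y(2) rc by simp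
      then show "y = \<zero>\<^bsub>S\<^esub>" using regular_elementsD[OF r x(1)] x(2) by simp
    qed (use rc in simp)
  qed
qed

lemma ring_iso_strongly_ISP_ring_iff:
  assumes "cring R" "ring S" "f \<in> ring_iso R S"
  shows "strongly_ISP_ring R \<longleftrightarrow> strongly_ISP_ring S"
proof -
  interpret R: cring R by fact
  have S: "cring S" by (rule ring_iso_cring[OF assms])
  have "inv_into (carrier R) f \<in> ring_iso S R" using R.ring_axioms assms(3) by (rule ring_iso_set_sym)
  then show ?thesis
    using ring_iso_strongly_ISP_ring[OF assms(1) S assms(3)] ring_iso_strongly_ISP_ring[OF S assms(1)]
    by blast
qed

lemma cring_RDirProd_list:
  assumes "\<forall>R\<in>set Rs. cring R"
  shows "cring (RDirProd_list Rs)"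
  using assms
proof (induction Rs)
  \<comment> \<open>The empty product is the zero ring, which \<open>cring\<close> admits.\<close>
  case Nil
  have "ring (RDirProd_list [])" by (rule RDirProd_list_is_ring) simp
  then show ?case
    by (intro cring.intro ring.is_monoid monoid.monoid_comm_monoidI) (auto simp: monoid.defs)
next
  case (Cons R Rs)
  interpret cring_pair R "RDirProd_list Rs" using Cons by (intro cring_pair.intro) auto
  have "ring (RDirProd_list (R # Rs))"
    using Cons.prems by (intro RDirProd_list_is_ring) (metis nth_mem cring.axioms(1))
  then show ?case by (rule ring_iso_cring[OF cring_P _ RDirProd_list_iso1])
qed

text \<open>Splitting off the first factor reduces the claim to a product of two rings. The
  induction starts at one factor because the empty product is the zero ring, which is not strongly
  ISP.\<close>

lemma strongly_ISP_ring_RDirProd_list_iff: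
  assumes "Rs \<noteq> []" "\<forall>R\<in>set Rs. nonzero_cring R"
  shows "strongly_ISP_ring (RDirProd_list Rs) \<longleftrightarrow> (\<forall>R\<in>set Rs. strongly_ISP_ring R)"
  using assms
proof (induction Rs rule: list_nonempty_induct)
  case (single R)
  then have R: "cring R" by (simp add: nonzero_cring_def)
  then have "ring (RDirProd_list [R])" using cring_RDirProd_list[of "[R]"] cring.axioms(1) by auto
  then show ?case using ring_iso_strongly_ISP_ring_iff[OF R _ RDirProd_list_iso3] by simp
next
  case (cons R Rs)
  have cr: "\<forall>Q\<in>set (R # Rs). cring Q" using cons.prems by (auto simp: nonzero_cring_def)
  interpret cring_pair R "RDirProd_list Rs"
    using cr by (intro cring_pair.intro cring_RDirProd_list) auto
  have R: "\<one>\<^bsub>R\<^esub> \<noteq> \<zero>\<^bsub>R\<^esub>"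
    using cons.prems by (simp add: nonzero_cring_def nonzero_cring_axioms_def)
  \<comment> \<open>Since \<open>Rs\<close> is not empty, its first entry already distinguishes one
    from zero.\<close>
  have Rs: "\<one>\<^bsub>RDirProd_list Rs\<^esub> \<noteq> \<zero>\<^bsub>RDirProd_list Rs\<^esub>"
    using cons.hyps cons.prems
    by (cases Rs) (auto simp: RDirProd_list_one RDirProd_list_zero nonzero_cring_def nonzero_cring_axioms_def)
  have "strongly_ISP_ring (RDirProd_list (R # Rs)) \<longleftrightarrow> strongly_ISP_ring P"
    using ring_iso_strongly_ISP_ring_iff[OF cring_P _ RDirProd_list_iso1]
      cring.axioms(1)[OF cring_RDirProd_list[OF cr]] by blast
  also have "\<dots> \<longleftrightarrow> strongly_ISP_ring R \<and> strongly_ISP_ring (RDirProd_list Rs)"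
    by (rule strongly_ISP_ring_P_iff[OF R Rs])
  finally show ?case using cons by simp
qed

text \<open>The convention that rings are nonzero appears as side conditions: zero outside
  \<open>S\<close> keeps A_S from being the zero ring, and a nonempty list does the same for the
  product.\<close>

theorem proposition4p2:
  fixes A :: "('a, 'm) ring_scheme"
    and As :: "('b, 'n) ring_scheme list"
  shows "(\<forall>P. strongly_ISP_ring A \<and> primeideal P A \<longrightarrow> ISP_domain (A Quot P)) \<and>
    (\<forall>S. strongly_ISP_ring A \<and> submonoid S A \<and> \<zero>\<^bsub>A\<^esub> \<notin> S \<longrightarrow>
       strongly_ISP_ring (localization A S)) \<and>
    (As \<noteq> [] \<and> (\<forall>R\<in>set As. nonzero_cring R) \<longrightarrow>
       (strongly_ISP_ring (RDirProd_list As) \<longleftrightarrow> (\<forall>R\<in>set As. strongly_ISP_ring R)))"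
  by (intro conjI allI impI; elim conjE)
    (rule ISP_domain_quotient strongly_ISP_ring_localization_submonoid
      strongly_ISP_ring_RDirProd_list_iff; assumption)+

end
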